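(* Let $m\in\mathbb{Z}_{>0}$ and let $\kappa=(g,g',m)\in S(m)$ satisfy $m=g+g'-p^{s(g)}$. Then $\kappa\in Z(p^{s(g)})$, i.e. $\kappa$ is the center of a connected component of $\Lambda^{\mathrm{bal}}_{>0}$ and $\Delta(\kappa)=p^{s(g)}$.
   Context: Let $p$ be a prime, $\mathbb{F}=\mathbb{F}_p$, $S=\mathbb{F}[x,y]$, $\mathrm{Der}_S=S\partial_x\oplus S\partial_y$. Let $\mathcal{A}=\{H_1,H_2,H_3\}$ with $H_1=\ker x$, $H_2=\ker y$, $H_3=\ker(x+y)$, $\alpha_1=x,\alpha_2=y,\alpha_3=x+y$. For $\mu\in\Lambda\coloneqq\mathbb{Z}_{\ge0}^3$, $D(\mathcal{A},\mu)=\{\theta\in\mathrm{Der}_S:\theta(\alpha_i)\in\alpha_i^{\mu_i}S,\ i=1,2,3\}$; it is free of rank 2 with a homogeneous basis whose degrees (exponents) are unique up to order and sum to $|\mu|=\mu_1+\mu_2+\mu_3$; $\Delta(\mu)$ is the absolute difference of the exponents. $\mu$ is balanced if $\mu_i\le|\mu|/2$ for all $i$; $\Lambda_{>0}=\{\mu:\Delta(\mu)>0\}$, $\Lambda^{\mathrm{bal}}_{>0}$ its balanced part. Elements are adjacent if they differ by $\pm\mathbf{e}_i$; connected components of $\Lambda_{>0}$ are the classes of the equivalence relation generated by adjacency within $\Lambda_{>0}$. It is known (Abe–Numata) that $\Lambda^{\mathrm{bal}}_{>0}$ is a union of connected components of $\Lambda_{>0}$, each of the form $\{\mu:|\mu-\zeta|<\Delta(\zeta)\}$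 for a unique element $\zeta$ (its center), characterized as the unique element of the component with $\Delta(\zeta)>\Delta(\nu)$ for all $\nu$ adjacent to $\zeta$. $Z$ is the set of these centers and $Z(p^k)=\{\zeta\in Z:\Delta(\zeta)=p^k\}$. Write base-$p$ expansions $n=\sum_{e\ge0}c_e(n)p^e$, $0\le c_e(n)<p$, and for $n>0$ let $s(n)=\min\{e:c_e(n)\ne0\}$. Let $G_m=\{g\in\mathbb{Z}_{\ge0}:c_e(g)\le c_e(m)\text{ for all }e\}=\{g_0,\dots,g_t\}$ with $0=g_0<g_1<\dots<g_t=m$, and $S(m)=\{(g_i,g_{t-i+1},m):i\in\{1,\dots,t\}\}$. *)

theory Defs
  imports
    "Berlekamp_Zassenhaus.Finite_Field"
    "HOL-Library.Product_Plus"
begin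

section \<open>Derivations of the polynomial ring in two variables\<close>

text \<open>
  The ring \<open>K[x,y]\<close> is rendered as \<open>K[x][y]\<close>, i.e. as \<open>'a poly poly\<close>: the coefficient of
  \<open>x^i y^j\<close> in \<open>f\<close> is \<open>coeff (coeff f j) i\<close>.
\<close>

definition var_x :: "'a::field poly poly" where
  "var_x = [:[:0, 1:]:]"

definition var_y :: "'a::field poly poly" where
  "var_y = [:0, 1:]"

definition d_x :: "'a::field poly poly \<Rightarrow> 'a poly poly" where
  "d_x f = map_poly pderiv f"

definition d_y :: "'a::field poly poly \<Rightarrow> 'a poly poly" where
  "d_y f = pderiv f"

definition homogeneous :: "nat \<Rightarrow> 'a::field poly poly \<Rightarrow> bool" where
  "homogeneous d f \<longleftrightarrow> (\<forall>i j. coeff (coeff f j) i \<noteq> 0 \<longrightarrow> i + j = d)"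

text \<open>The pair \<open>(a, b)\<close> stands for the derivation \<open>a \<partial>\<^sub>x + b \<partial>\<^sub>y\<close>.\<close>

type_synonym 'a der = "'a poly poly \<times> 'a poly poly"

definition der_apply :: "'a::field der \<Rightarrow> 'a poly poly \<Rightarrow> 'a poly poly" where
  "der_apply \<theta> f = fst \<theta> * d_x f + snd \<theta> * d_y f"

definition der_scale :: "'a::field poly poly \<Rightarrow> 'a der \<Rightarrow> 'a der" where
  "der_scale f \<theta> = (f * fst \<theta>, f * snd \<theta>)"

interpretation der: Modules.module der_scale
  by unfold_locales (auto simp: der_scale_def algebra_simps)

definition der_homogeneous :: "nat \<Rightarrow> 'a::field der \<Rightarrow> bool" where
  "der_homogeneous d \<theta> \<longleftrightarrow> homogeneous d (fst \<theta>) \<and> homogeneous d (snd \<theta>)"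


section \<open>Multiplicities on the arrangement of \<open>x\<close>, \<open>y\<close>, \<open>x + y\<close>\<close>

type_synonym mult = "nat \<times> nat \<times> nat"

definition D_mod :: "mult \<Rightarrow> 'a::field der set" where
  "D_mod = (\<lambda>(\<mu>1, \<mu>2, \<mu>3). {\<theta>.
     var_x ^ \<mu>1 dvd der_apply \<theta> var_x \<and>
     var_y ^ \<mu>2 dvd der_apply \<theta> var_y \<and>
     (var_x + var_y) ^ \<mu>3 dvd der_apply \<theta> (var_x + var_y)})"

definition homogeneous_basis :: "mult \<Rightarrow> nat \<Rightarrow> 'a::field der \<Rightarrow> nat \<Rightarrow> 'a der \<Rightarrow> bool" where
  "homogeneous_basis \<mu> d1 \<theta>1 d2 \<theta>2 \<longleftrightarrow>
     der_homogeneous d1 \<theta>1 \<and> der_homogeneous d2 \<theta>2 \<and>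
     \<theta>1 \<noteq> \<theta>2 \<and> \<not> der.dependent {\<theta>1, \<theta>2} \<and> der.span {\<theta>1, \<theta>2} = D_mod \<mu>"

text \<open>
  The module \<open>D_mod \<mu>\<close> depends on the ground field, which is passed on as a type argument.
\<close>

definition exponents :: "'a::field itself \<Rightarrow> mult \<Rightarrow> nat \<Rightarrow> nat \<Rightarrow> bool" where
  "exponents K \<mu> d1 d2 \<longleftrightarrow> (\<exists>\<theta>1 \<theta>2 :: 'a der. homogeneous_basis \<mu> d1 \<theta>1 d2 \<theta>2)"

definition \<Delta> :: "'a::field itself \<Rightarrow> mult \<Rightarrow> nat" where
  "\<Delta> K \<mu> = (THE \<delta>. \<exists>d1 d2. exponents K \<mu> d1 d2 \<and> int \<delta> = \<bar>int d1 - int d2\<bar>)"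


section \<open>Components and their centers\<close>

definition mult_size :: "mult \<Rightarrow> nat" where
  "mult_size = (\<lambda>(\<mu>1, \<mu>2, \<mu>3). \<mu>1 + \<mu>2 + \<mu>3)"

definition mult_dist :: "mult \<Rightarrow> mult \<Rightarrow> int" where
  "mult_dist = (\<lambda>(\<mu>1, \<mu>2, \<mu>3) (\<nu>1, \<nu>2, \<nu>3).
     \<bar>int \<mu>1 - int \<nu>1\<bar> + \<bar>int \<mu>2 - int \<nu>2\<bar> + \<bar>int \<mu>3 - int \<nu>3\<bar>)"

definition balanced :: "mult \<Rightarrow> bool" where
  "balanced \<mu> \<longleftrightarrow>
     (case \<mu> of (\<mu>1, \<mu>2, \<mu>3) \<Rightarrow>
       2 * \<mu>1 \<le> mult_size \<mu> \<and> 2 * \<mu>2 \<le> mult_size \<mu> \<and> 2 * \<mu>3 \<le> mult_size \<mu>)"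

definition adjacent :: "mult \<Rightarrow> mult \<Rightarrow> bool" where
  "adjacent \<mu> \<nu> \<longleftrightarrow>
     (\<exists>e \<in> {(1, 0, 0), (0, 1, 0), (0, 0, 1)}. \<nu> = \<mu> + e \<or> \<mu> = \<nu> + e)"

definition \<Lambda>_pos :: "'a::field itself \<Rightarrow> mult set" where
  "\<Lambda>_pos K = {\<mu>. \<Delta> K \<mu> > 0}"

definition \<Lambda>_pos_bal :: "'a::field itself \<Rightarrow> mult set" where
  "\<Lambda>_pos_bal K = {\<mu> \<in> \<Lambda>_pos K. balanced \<mu>}"

text \<open>
  Adjacency is symmetric, so its reflexive transitive closure is the equivalence
  relation that it generates.
\<close>

definition components :: "'a::field itself \<Rightarrow> mult set set" where
  "components K =
     \<Lambda>_pos K // {(\<mu>, \<nu>). \<mu> \<in> \<Lambda>_pos K \<and> \<nu> \<in> \<Lambda>_pos K \<and> adjacent \<mu> \<nu>}\<^sup>*"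

text \<open>
  A component has at most one center: a non-empty ball in the 1-norm on triples of natural
  numbers determines its center and radius, by the maxima over the ball of the three
  coordinates and of their sum.
\<close>

definition is_center :: "'a::field itself \<Rightarrow> mult set \<Rightarrow> mult \<Rightarrow> bool" where
  "is_center K C \<zeta> \<longleftrightarrow> C = {\<mu>. mult_dist \<mu> \<zeta> < int (\<Delta> K \<zeta>)}"

definition centers :: "'a::field itself \<Rightarrow> mult set" where
  "centers K = {\<zeta>. \<exists>C \<in> components K. C \<subseteq> \<Lambda>_pos_bal K \<and> is_center K C \<zeta>}"

definition centers_level :: "'a::field itself \<Rightarrow> nat \<Rightarrow> mult set" where
  "centers_level K n = {\<zeta> \<in> centers K. \<Delta> K \<zeta> = n}"


section \<open>Base \<open>p\<close> expansions\<close>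

definition digit :: "nat \<Rightarrow> nat \<Rightarrow> nat \<Rightarrow> nat" where
  "digit p e n = n div p ^ e mod p"

definition low_exp :: "nat \<Rightarrow> nat \<Rightarrow> nat" where
  "low_exp p n = (LEAST e. digit p e n \<noteq> 0)"

definition G_set :: "nat \<Rightarrow> nat \<Rightarrow> nat set" where
  "G_set p m = {g. \<forall>e. digit p e g \<le> digit p e m}"

text \<open>\<open>g_enum p m i\<close> is the element \<open>g\<^sub>i\<close> of \<open>G_set p m = {g\<^sub>0 < \<dots> < g\<^sub>t}\<close>, a finite set when \<open>p > 1\<close>.\<close>

definition g_enum :: "nat \<Rightarrow> nat \<Rightarrow> nat \<Rightarrow> nat" where
  "g_enum p m i = sorted_list_of_set (G_set p m) ! i"

definition S_set :: "nat \<Rightarrow> nat \<Rightarrow> mult set" where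
  "S_set p m = (let t = card (G_set p m) - 1 in
     {(g_enum p m i, g_enum p m (t - i + 1), m) | i. i \<in> {1..t}})"

end

theory Submission
  imports Defs
begin

text \<open>
  Let \<open>q = p ^ s(g)\<close>. By Lucas's theorem \<open>G_set p m\<close> is the set of \<open>i\<close> for which the binomial
  coefficient of \<open>m\<close> over \<open>i\<close> is nonzero in the field, and \<open>g - q = m - g'\<close> is the predecessor of
  \<open>g\<close> in it. So \<open>(x + y) ^ m\<close> has no monomials strictly inside this gap and splits as \<open>a + b\<close>
  with \<open>x ^ g dvd a\<close> and \<open>y ^ g' dvd b\<close>, which yields an element \<open>\<theta> = a \<partial>\<^sub>x + b \<partial>\<^sub>y\<close> of
  degree \<open>m\<close> of the module at \<open>\<kappa> = (g, g', m)\<close>. As \<open>\<theta>\<close> is primitive and lies in the module of no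
  larger multiplicity, at distance \<open>r \<le> q\<close> from \<open>\<kappa>\<close> the product of \<open>\<theta>\<close> with the necessary linear forms cannot be a
  proper multiple of an element, hence has the lower of the two exponents. The exponents sum to the
  size of the multiplicity, so they differ by \<open>q - r\<close>: the open ball of radius \<open>q\<close> around \<open>\<kappa>\<close> is
  contained in the support of \<open>\<Delta>\<close>, and \<open>\<Delta>\<close> vanishes on the bounding sphere.
\<close>

section \<open>Polynomials in two variables\<close>

text \<open>Divisibility by \<open>[:c, 1:]\<close> is vanishing at \<open>- c\<close>, and
  evaluation takes values in a domain.\<close>

lemma prime_elem_linear_poly: "prime_elem [:c, 1:]" for c :: "'a::idom"
proof (rule prime_elemI)
  show "[:c, 1:] \<noteq> 0" by simp
  show "\<not> [:c, 1:] dvd 1"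
    using poly_eq_0_iff_dvd[of 1 "- c"] by simp
  show "[:c, 1:] dvd a \<or> [:c, 1:] dvd b" if "[:c, 1:] dvd a * b" for a b
    using that poly_eq_0_iff_dvd[of _ "- c"] by (metis minus_minus mult_eq_0_iff poly_mult)
qed

lemma prime_elem_var_x: "prime_elem (var_x :: 'a::field poly poly)"
  unfolding var_x_def using lift_prime_elem_poly[OF prime_elem_linear_poly[of 0]] by simp

lemma prime_elem_var_y: "prime_elem (var_y :: 'a::field poly poly)"
  unfolding var_y_def by (rule prime_elem_linear_poly)

lemma var_x_plus_var_y: "var_x + var_y = ([:[:0, 1:], 1:] :: 'a::field poly poly)"
  by (simp add: var_x_def var_y_def)

lemma prime_elem_var_x_plus_var_y: "prime_elem (var_x + var_y :: 'a::field poly poly)"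
  unfolding var_x_plus_var_y by (rule prime_elem_linear_poly)

lemma var_x_plus_var_y_dvd_iff:
  "var_x + var_y dvd (f :: 'a::field poly poly) \<longleftrightarrow> poly f [:0, -1:] = 0"
  using poly_eq_0_iff_dvd[of f "[:0, -1:]"] by (simp add: var_x_plus_var_y)

lemma coeff_var_x_mult: "coeff (coeff (var_x * f) j) i = (if i = 0 then 0 else coeff (coeff f j) (i - 1))"
  by (cases i) (simp_all add: var_x_def)

lemma coeff_var_y_mult: "coeff (var_y * f) j = (if j = 0 then 0 else coeff f (j - 1))"
  by (cases j) (simp_all add: var_y_def)

lemma coeff_var_x_power_dvd:
  assumes "var_x ^ n dvd f" "i < n" shows "coeff (coeff f j) i = 0"
proof -
  have "\<forall>i<n. coeff (coeff (var_x ^ n * h) j) i = 0" for h :: "'a::field poly poly"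
    by (induction n) (auto simp: mult.assoc coeff_var_x_mult)
  thus ?thesis using assms by (auto elim: dvdE)
qed

lemma coeff_var_y_power_dvd:
  assumes "var_y ^ n dvd f" "j < n" shows "coeff f j = 0"
proof -
  have "\<forall>j<n. coeff (var_y ^ n * h) j = 0" for h :: "'a::field poly poly"
    by (induction n) (auto simp: mult.assoc coeff_var_y_mult)
  thus ?thesis using assms by (auto elim: dvdE)
qed

lemma var_x_power_eq_monom: "var_x ^ n = ([:monom 1 n:] :: 'a::field poly poly)"
  by (induction n) (simp_all add: var_x_def monom_Suc one_pCons)

lemma var_y_power_eq_monom: "var_y ^ n = (monom 1 n :: 'a::field poly poly)"
  by (induction n) (simp_all add: var_y_def monom_Suc)

lemma coeff_var_x_power_mult_var_y_power:
  "coeff (coeff (var_x ^ i * var_y ^ j :: 'a::field poly poly) l) k = (if k = i \<and> l = j then 1 else 0)"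
  by (auto simp: var_x_power_eq_monom var_y_power_eq_monom)

section \<open>Homogeneous components\<close>

definition homogeneous_part :: "nat \<Rightarrow> 'a::field poly poly \<Rightarrow> 'a poly poly" where
  "homogeneous_part d f = (\<Sum>j\<le>d. monom (monom (coeff (coeff f j) (d - j)) (d - j)) j)"

lemma coeff_homogeneous_part: "coeff (coeff (homogeneous_part d f) j) i = (if i + j = d then coeff (coeff f j) i else 0)"
proof -
  have "coeff (coeff (homogeneous_part d f) j) i
      = (\<Sum>j'\<le>d. if j' = j then (if i = d - j then coeff (coeff f j) i else 0) else 0)"
    unfolding homogeneous_part_def coeff_sum
    by (intro sum.cong) auto
  thus ?thesis by (auto simp: sum.delta)
qed

lemma poly_poly_eqI: "(\<And>i j. coeff (coeff f j) i = coeff (coeff g j) i) \<Longrightarrow> f = g"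
  by (intro poly_eqI) auto

lemma homogeneous_part_add: "homogeneous_part d (f + g) = homogeneous_part d f + homogeneous_part d g"
  by (rule poly_poly_eqI) (auto simp: coeff_homogeneous_part)

lemma homogeneous_homogeneous_part: "homogeneous d (homogeneous_part d f)"
  by (auto simp: homogeneous_def coeff_homogeneous_part split: if_splits)

lemma homogeneous_part_homogeneous: "homogeneous d f \<Longrightarrow> homogeneous_part d f = f"
  by (rule poly_poly_eqI) (auto simp: coeff_homogeneous_part homogeneous_def)

lemma coeff_coeff_mult:
  "coeff (coeff (f * g) j) i
    = (\<Sum>k\<le>j. \<Sum>l\<le>i. coeff (coeff f k) l * coeff (coeff g (j - k)) (i - l))"
  by (simp add: coeff_mult coeff_sum)

text \<open>Every monomial of \<open>g\<close> has degree \<open>e\<close>, so a term of the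
  convolution lands in degree \<open>d + e\<close> exactly when its factor from \<open>f\<close> has
  degree \<open>d\<close>; \<open>f\<close> itself is arbitrary.\<close>

lemma homogeneous_part_mult:
  assumes "homogeneous e g"
  shows "homogeneous_part (d + e) (f * g) = homogeneous_part d f * g"
proof (rule poly_poly_eqI)
  fix i j
  have eq: "(if i + j = d + e then coeff (coeff f k) l * coeff (coeff g (j - k)) (i - l) else 0)
     = coeff (coeff (homogeneous_part d f) k) l * coeff (coeff g (j - k)) (i - l)"
    if "k \<le> j" "l \<le> i" for k l
  proof (cases "coeff (coeff g (j - k)) (i - l) = 0")
    case False
    hence "i - l + (j - k) = e" using assms by (auto simp: homogeneous_def)
    hence "i + j = d + e \<longleftrightarrow> l + k = d" using that by auto
    thus ?thesis by (simp add: coeff_homogeneous_part)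
  qed simp
  have "coeff (coeff (homogeneous_part (d + e) (f * g)) j) i
     = (\<Sum>k\<le>j. \<Sum>l\<le>i. if i + j = d + e then coeff (coeff f k) l * coeff (coeff g (j - k)) (i - l) else 0)"
    by (auto simp: coeff_homogeneous_part coeff_coeff_mult)
  also have "\<dots> = coeff (coeff (homogeneous_part d f * g) j) i"
    unfolding coeff_coeff_mult by (intro sum.cong refl eq) auto
  finally show "coeff (coeff (homogeneous_part (d + e) (f * g)) j) i = coeff (coeff (homogeneous_part d f * g) j) i" .
qed

lemma homogeneous_part_mult_less:
  assumes "homogeneous e g" "d < e"
  shows "homogeneous_part d (f * g) = 0"
proof (rule poly_poly_eqI)
  fix i j
  have "coeff (coeff f k) l * coeff (coeff g (j - k)) (i - l) = 0"
    if "k \<le> j" "l \<le> i" "i + j = d" for k l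
  proof -
    have "i - l + (j - k) \<noteq> e" using assms(2) that by linarith
    thus ?thesis using assms(1) by (auto simp: homogeneous_def)
  qed
  thus "coeff (coeff (homogeneous_part d (f * g)) j) i = coeff (coeff 0 j) i"
    by (auto simp: coeff_homogeneous_part coeff_coeff_mult intro!: sum.neutral)
qed

lemma homogeneous_0 [simp]: "homogeneous d 0"
  by (simp add: homogeneous_def)

lemma homogeneous_add: "homogeneous d f \<Longrightarrow> homogeneous d g \<Longrightarrow> homogeneous d (f + g)"
  by (metis homogeneous_part_add homogeneous_part_homogeneous homogeneous_homogeneous_part)

lemma homogeneous_mult:
  assumes "homogeneous d f" "homogeneous e g" shows "homogeneous (d + e) (f * g)"
  using homogeneous_part_mult[OF assms(2), of d f] assms(1) by (metis homogeneous_part_homogeneous homogeneous_homogeneous_part)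

lemma homogeneous_const: "homogeneous 0 [:[:c:]:]"
  by (auto simp: homogeneous_def coeff_pCons split: nat.splits)

lemma homogeneous_1 [simp]: "homogeneous 0 1"
  using homogeneous_const[of 1] by (simp add: one_pCons)

lemma homogeneous_power: "homogeneous d f \<Longrightarrow> homogeneous (d * n) (f ^ n)"
  by (induction n) (auto dest: homogeneous_mult)

lemma homogeneous_var_x: "homogeneous 1 var_x"
  by (auto simp: homogeneous_def var_x_def coeff_pCons split: nat.splits)

lemma homogeneous_var_y: "homogeneous 1 var_y"
  by (auto simp: homogeneous_def var_y_def coeff_pCons split: nat.splits)

lemma homogeneous_monomial:
  "homogeneous (i + j) (var_x ^ i * var_y ^ j)"
  using homogeneous_mult[OF homogeneous_power[OF homogeneous_var_x] homogeneous_power[OF homogeneous_var_y]]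
  by simp

lemma homogeneous_var_x_plus_var_y: "homogeneous 1 (var_x + var_y)"
  by (intro homogeneous_add homogeneous_var_x homogeneous_var_y)

text \<open>Comparing components of degree \<open>d\<close> gives
  \<open>homogeneous_part (d - e) f * g = f * g\<close>, and the nonzero \<open>g\<close>
  cancels.\<close>

lemma homogeneous_quotient:
  assumes "homogeneous e g" "homogeneous d (f * g)" "f * g \<noteq> 0"
  shows "e \<le> d" "homogeneous (d - e) f"
proof -
  have eq: "homogeneous_part d (f * g) = f * g" using assms(2) by (rule homogeneous_part_homogeneous)
  show le: "e \<le> d" using homogeneous_part_mult_less[OF assms(1), of d f] eq assms(3) by (cases "d < e") auto
  have "homogeneous_part (d - e) f * g = f * g" using homogeneous_part_mult[OF assms(1), of "d - e" f] eq le by force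
  hence "homogeneous_part (d - e) f = f" using assms(3) by (simp add: mult_right_cancel)
  thus "homogeneous (d - e) f" by (metis homogeneous_homogeneous_part)
qed

text \<open>Substituting \<open>-x\<close> for \<open>y\<close> is reduction modulo \<open>x + y\<close>.\<close>

lemma homogeneous_poly_antidiagonal:
  assumes "homogeneous d f" shows "\<exists>c. poly f [:0, -1:] = monom c d"
proof -
  have "\<exists>c. coeff f j * [:0, -1:] ^ j = monom c d" for j
  proof (cases "j \<le> d")
    case True
    have "coeff f j = monom (coeff (coeff f j) (d - j)) (d - j)"
      using assms True by (intro poly_eqI) (force simp: homogeneous_def)
    moreover have "[:0, -1:] ^ j = monom ((-1) ^ j :: 'a) j"
      by (induction j) (simp_all add: monom_Suc one_pCons monom_0 smult_monom)
    ultimately have "coeff f j * [:0, -1:] ^ j = monom (coeff (coeff f j) (d - j) * (-1) ^ j) (d - j + j)"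
      by (metis mult_monom)
    thus ?thesis using True by auto
  next
    case False
    hence "coeff f j = 0" using assms by (intro poly_eqI) (force simp: homogeneous_def)
    thus ?thesis by (auto intro: exI[of _ 0])
  qed
  then obtain c where "\<And>j. coeff f j * [:0, -1:] ^ j = monom (c j) d" by metis
  hence "poly f [:0, -1:] = monom (\<Sum>j\<le>degree f. c j) d"
    by (simp add: poly_altdef monom_sum)
  thus ?thesis by blast
qed

section \<open>Homogeneous bases and exponents\<close>

text \<open>The derivation takes the values \<open>a\<close>, \<open>b\<close> and
  \<open>a + b\<close> on the three linear forms.\<close>

lemma mem_D_mod_iff:
  "(a, b) \<in> D_mod (i, j, k) \<longleftrightarrow> var_x ^ i dvd a \<and> var_y ^ j dvd b \<and> (var_x + var_y) ^ k dvd a + b"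
proof -
  have "d_x var_x = (1 :: 'a poly poly)" "d_y var_x = (0 :: 'a poly poly)"
    "d_x var_y = (0 :: 'a poly poly)" "d_y var_y = (1 :: 'a poly poly)"
    "d_x (var_x + var_y) = (1 :: 'a poly poly)" "d_y (var_x + var_y) = (1 :: 'a poly poly)"
    by (simp_all add: d_x_def d_y_def var_x_def var_y_def map_poly_pCons pderiv_pCons one_pCons)
  thus ?thesis by (simp add: D_mod_def der_apply_def)
qed

lemma homogeneous_basis_iff:
  "homogeneous_basis \<mu> d1 (a1, b1) d2 (a2, b2) \<longleftrightarrow>
     homogeneous d1 a1 \<and> homogeneous d1 b1 \<and> homogeneous d2 a2 \<and> homogeneous d2 b2 \<and>
     (\<forall>f h. f * a1 + h * a2 = 0 \<and> f * b1 + h * b2 = 0 \<longrightarrow> f = 0 \<and> h = 0) \<and>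
     (\<forall>a b. (a, b) \<in> D_mod \<mu> \<longleftrightarrow> (\<exists>f h. a = f * a1 + h * a2 \<and> b = f * b1 + h * b2))"
  (is "_ \<longleftrightarrow> ?thesis'")
proof -
  let ?\<theta>1 = "(a1, b1)" and ?\<theta>2 = "(a2, b2)"
  have indep: "?\<theta>1 \<noteq> ?\<theta>2 \<and> \<not> der.dependent {?\<theta>1, ?\<theta>2} \<longleftrightarrow>
    (\<forall>f h. f * a1 + h * a2 = 0 \<and> f * b1 + h * b2 = 0 \<longrightarrow> f = 0 \<and> h = 0)" (is "?L \<longleftrightarrow> ?R")
  proof (cases "?\<theta>1 = ?\<theta>2")
    case True
    have "\<not> ?R" 
    proof
      assume ?R
      \<comment> \<open>For coinciding elements the relation has coefficients 1 and -1; the set,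
        then a singleton, would not show it.\<close>
      hence "1 * a1 + (-1) * a2 = 0 \<and> 1 * b1 + (-1) * b2 = 0 \<longrightarrow> (1::'a poly poly) = 0 \<and> (-1::'a poly poly) = 0" by blast
      thus False using True by simp
    qed
    thus ?thesis using True by simp
  next
    case False
    have "der.dependent {?\<theta>1, ?\<theta>2} \<longleftrightarrow>
       (\<exists>u. (u ?\<theta>1 \<noteq> 0 \<or> u ?\<theta>2 \<noteq> 0) \<and> u ?\<theta>1 * a1 + u ?\<theta>2 * a2 = 0 \<and> u ?\<theta>1 * b1 + u ?\<theta>2 * b2 = 0)"
      using False by (subst der.dependent_finite) (auto simp: der_scale_def zero_prod_def)
    also have "\<dots> \<longleftrightarrow> \<not> ?R"
    proof
      assume "\<not> ?R"
      then obtain f h where *: "f * a1 + h * a2 = 0" "f * b1 + h * b2 = 0" "f \<noteq> 0 \<or> h \<noteq> 0" by blast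
      show "\<exists>u. (u ?\<theta>1 \<noteq> 0 \<or> u ?\<theta>2 \<noteq> 0) \<and> u ?\<theta>1 * a1 + u ?\<theta>2 * a2 = 0 \<and> u ?\<theta>1 * b1 + u ?\<theta>2 * b2 = 0"
        using * False by (intro exI[of _ "\<lambda>v. if v = ?\<theta>1 then f else h"]) auto
    qed blast
    finally show ?thesis using False by blast
  qed
  have span: "(a, b) \<in> der.span {?\<theta>1, ?\<theta>2} \<longleftrightarrow>
      (\<exists>f h. a = f * a1 + h * a2 \<and> b = f * b1 + h * b2)" for a b
    by (simp add: der.span_breakdown_eq der_scale_def zero_prod_def algebra_simps)
  have "der.span {?\<theta>1, ?\<theta>2} = D_mod \<mu> \<longleftrightarrow>
      (\<forall>a b. (a, b) \<in> D_mod \<mu> \<longleftrightarrow> (a, b) \<in> der.span {?\<theta>1, ?\<theta>2})"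
    unfolding set_eq_iff split_paired_All by blast
  hence D: "der.span {?\<theta>1, ?\<theta>2} = D_mod \<mu> \<longleftrightarrow>
      (\<forall>a b. (a, b) \<in> D_mod \<mu> \<longleftrightarrow> (\<exists>f h. a = f * a1 + h * a2 \<and> b = f * b1 + h * b2))"
    unfolding span .
  have "homogeneous_basis \<mu> d1 ?\<theta>1 d2 ?\<theta>2 \<longleftrightarrow>
      der_homogeneous d1 ?\<theta>1 \<and> der_homogeneous d2 ?\<theta>2 \<and>
      (?\<theta>1 \<noteq> ?\<theta>2 \<and> \<not> der.dependent {?\<theta>1, ?\<theta>2}) \<and> der.span {?\<theta>1, ?\<theta>2} = D_mod \<mu>"
    unfolding homogeneous_basis_def by (simp only: conj_assoc)
  also have "\<dots> \<longleftrightarrow> ?thesis'"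
    unfolding indep D der_homogeneous_def fst_conv snd_conv by (simp only: conj_assoc)
  finally show ?thesis .
qed

lemma homogeneous_basis_swap:
  "homogeneous_basis \<mu> d1 \<theta>1 d2 \<theta>2 \<Longrightarrow> homogeneous_basis \<mu> d2 \<theta>2 d1 \<theta>1"
  unfolding homogeneous_basis_def by (auto simp: insert_commute)

lemma homogeneous_basisD:
  assumes "homogeneous_basis \<mu> d1 (a1, b1) d2 (a2, b2)"
  shows "homogeneous d1 a1" "homogeneous d1 b1" "homogeneous d2 a2" "homogeneous d2 b2"
    and "f * a1 + h * a2 = 0 \<Longrightarrow> f * b1 + h * b2 = 0 \<Longrightarrow> f = 0 \<and> h = 0"
    and "(a, b) \<in> D_mod \<mu> \<longleftrightarrow> (\<exists>f h. a = f * a1 + h * a2 \<and> b = f * b1 + h * b2)"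
    and "(f * a1 + h * a2, f * b1 + h * b2) \<in> D_mod \<mu>"
    and "(a1, b1) \<in> D_mod \<mu>" "(a2, b2) \<in> D_mod \<mu>"
proof -
  note B = assms[unfolded homogeneous_basis_iff]
  show "homogeneous d1 a1" "homogeneous d1 b1" "homogeneous d2 a2" "homogeneous d2 b2"
    using B by - (elim conjE, assumption)+
  show "f * a1 + h * a2 = 0 \<Longrightarrow> f * b1 + h * b2 = 0 \<Longrightarrow> f = 0 \<and> h = 0"
    using B by blast
  show mem_iff: "(a, b) \<in> D_mod \<mu> \<longleftrightarrow> (\<exists>f h. a = f * a1 + h * a2 \<and> b = f * b1 + h * b2)" for a b
    using B by (elim conjE) (erule allE, erule allE, assumption)
  show mem: "(f * a1 + h * a2, f * b1 + h * b2) \<in> D_mod \<mu>" for f h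
    unfolding mem_iff by blast
  show "(a1, b1) \<in> D_mod \<mu>" "(a2, b2) \<in> D_mod \<mu>"
    using mem[of 1 0] mem[of 0 1] by simp_all
qed

lemma homogeneous_basisI:
  assumes "homogeneous d1 a1" "homogeneous d1 b1" "homogeneous d2 a2" "homogeneous d2 b2"
    and "\<And>f h. f * a1 + h * a2 = 0 \<Longrightarrow> f * b1 + h * b2 = 0 \<Longrightarrow> f = 0 \<and> h = 0"
    and "\<And>a b. (a, b) \<in> D_mod \<mu> \<longleftrightarrow> (\<exists>f h. a = f * a1 + h * a2 \<and> b = f * b1 + h * b2)"
  shows "homogeneous_basis \<mu> d1 (a1, b1) d2 (a2, b2)"
  unfolding homogeneous_basis_iff
  by (intro conjI assms(1-4) allI impI) (use assms(5,6) in \<open>blast+\<close>)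

text \<open>This change of basis is inverted by the shear with \<open>- c\<close>. Writing the
  second degree as \<open>d1 + e\<close> keeps the new element homogeneous.\<close>

lemma homogeneous_basis_shear:
  assumes "homogeneous_basis \<mu> d1 (a1, b1) (d1 + e) (a2, b2)" "homogeneous e c"
  shows "homogeneous_basis \<mu> d1 (a1, b1) (d1 + e) (a2 + c * a1, b2 + c * b1)"
proof (rule homogeneous_basisI)
  note B = homogeneous_basisD[OF assms(1)]
  have hom: "homogeneous (d1 + e) (c * a1)" "homogeneous (d1 + e) (c * b1)"
    using homogeneous_mult[OF assms(2), of d1] B(1,2) by (auto simp: add.commute)
  show "homogeneous d1 a1" "homogeneous d1 b1" by (rule B(1), rule B(2))
  show "homogeneous (d1 + e) (a2 + c * a1)" "homogeneous (d1 + e) (b2 + c * b1)"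
    by (intro homogeneous_add hom B(3,4))+
  have shear: "f * u1 + h * (u2 + c * u1) = (f + h * c) * u1 + h * u2" for f h u1 u2
    by (simp add: algebra_simps)
  show "f = 0 \<and> h = 0"
    if "f * a1 + h * (a2 + c * a1) = 0" "f * b1 + h * (b2 + c * b1) = 0" for f h
    using B(5)[of "f + h * c" h] that unfolding shear by auto
  show "(a, b) \<in> D_mod \<mu> \<longleftrightarrow>
      (\<exists>f h. a = f * a1 + h * (a2 + c * a1) \<and> b = f * b1 + h * (b2 + c * b1))" (is "?L \<longleftrightarrow> ?R") for a b
  proof
    assume ?L
    then obtain f h where "a = f * a1 + h * a2" "b = f * b1 + h * b2" unfolding B(6) by blast
    thus ?R unfolding shear by (intro exI[of _ "f - h * c"] exI[of _ h]) simp
  next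
    assume ?R
    thus ?L unfolding shear using B(7) by blast
  qed
qed

section \<open>Bases by induction on the third multiplicity\<close>

lemma prime_elem_dvd_of_power_Suc_dvd:
  fixes p :: "'a::idom"
  assumes p: "prime_elem p" and "p ^ k dvd u" "\<not> p ^ Suc k dvd u" "p ^ Suc k dvd f * u"
  shows "p dvd f"
proof -
  obtain v where u: "u = p ^ k * v" using assms(2) by (auto elim: dvdE)
  have "\<not> p dvd v" using assms(3) u by (auto simp: mult.commute)
  have "p ^ k * p dvd p ^ k * (f * v)" using assms(4) u by (simp add: mult_ac)
  hence "p dvd f * v" using p by (simp add: prime_elem_def)
  thus ?thesis using p \<open>\<not> p dvd v\<close> by (simp add: prime_elem_dvd_mult_iff)
qed

text \<open>
  If just one basis element violates the stronger divisibility condition, multiplying it by \<open>x + y\<close>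
  gives a basis for the next multiplicity; a shear arranges this situation in general.
\<close>

lemma homogeneous_basis_step:
  fixes a1 b1 a2 b2 :: "'a::field poly poly"
  assumes "homogeneous_basis (i, j, k) d1 (a1, b1) d2 (a2, b2)"
    and nd: "\<not> (var_x + var_y) ^ Suc k dvd a1 + b1" and dv: "(var_x + var_y) ^ Suc k dvd a2 + b2"
  shows "homogeneous_basis (i, j, Suc k)
    (Suc d1) ((var_x + var_y) * a1, (var_x + var_y) * b1) d2 (a2, b2)"
proof -
  let ?l = "var_x + var_y :: 'a poly poly"
  note B = homogeneous_basisD[OF assms(1)]
  have l0: "?l \<noteq> 0" using prime_elem_var_x_plus_var_y by (auto simp: prime_elem_def)
  have k1: "?l ^ k dvd a1 + b1" using B(8) by (simp add: mem_D_mod_iff)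
  \<comment> \<open>Modulo \<open>?l ^ Suc k\<close> the second element contributes nothing, so only
    \<open>f * (a1 + b1)\<close> decides.\<close>
  have key: "?l ^ Suc k dvd (f * a1 + h * a2) + (f * b1 + h * b2) \<longleftrightarrow> ?l dvd f" for f h
  proof -
    have "(f * a1 + h * a2) + (f * b1 + h * b2) = f * (a1 + b1) + h * (a2 + b2)"
      by (simp add: algebra_simps)
    moreover have "?l ^ Suc k dvd h * (a2 + b2)" using dv by simp
    moreover have "?l ^ Suc k dvd f * (a1 + b1) \<longleftrightarrow> ?l dvd f"
      using prime_elem_dvd_of_power_Suc_dvd[OF prime_elem_var_x_plus_var_y k1 nd]
        mult_dvd_mono[OF _ k1, of ?l f] unfolding power_Suc by blast
    ultimately show ?thesis by (simp only: dvd_add_left_iff)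
  qed
  have D: "(a, b) \<in> D_mod (i, j, Suc k) \<longleftrightarrow>
     (\<exists>f h. a = f * (?l * a1) + h * a2 \<and> b = f * (?l * b1) + h * b2)" (is "?L \<longleftrightarrow> ?R") for a b
  proof
    assume L: ?L
    hence "(a, b) \<in> D_mod (i, j, k)"
      unfolding mem_D_mod_iff power_Suc by (blast dest: dvd_mult_right)
    then obtain f h where fh: "a = f * a1 + h * a2" "b = f * b1 + h * b2" unfolding B(6) by blast
    have "?l dvd f" using L key[of f h] fh unfolding mem_D_mod_iff by blast
    then obtain f' where "f = ?l * f'" by (rule dvdE)
    thus ?R using fh by (intro exI[of _ f'] exI[of _ h]) (simp add: mult_ac)
  next
    assume ?R
    then obtain f h where fh: "a = f * (?l * a1) + h * a2" "b = f * (?l * b1) + h * b2" by blast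
    have "(f * ?l * a1 + h * a2, f * ?l * b1 + h * b2) \<in> D_mod (i, j, k)" by (rule B(7))
    moreover have "?l ^ Suc k dvd (f * ?l * a1 + h * a2) + (f * ?l * b1 + h * b2)"
      by (subst key) simp
    ultimately show ?L unfolding fh mem_D_mod_iff mult.assoc by blast
  qed
  have "f = 0 \<and> h = 0"
    if "f * (?l * a1) + h * a2 = 0" "f * (?l * b1) + h * b2 = 0" for f h
  proof -
    have "f * ?l = 0 \<and> h = 0" using B(5)[of "f * ?l" h] that by (simp only: mult.assoc)
    thus ?thesis using l0 by simp
  qed
  moreover have "homogeneous (Suc d1) (?l * a1)" "homogeneous (Suc d1) (?l * b1)"
    using homogeneous_mult[OF homogeneous_var_x_plus_var_y, of d1] B(1,2) by auto
  ultimately show ?thesis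
    using B(3,4) D by (intro homogeneous_basisI)
qed

text \<open>With third multiplicity zero the conditions on the two coefficients decouple; this
  starts the induction.\<close>

lemma homogeneous_basis_0:
  "homogeneous_basis (i, j, 0) i (var_x ^ i, 0) j (0, var_y ^ j)"
proof -
  have "var_x ^ i \<noteq> (0 :: 'a poly poly)" "var_y ^ j \<noteq> (0 :: 'a poly poly)"
    using prime_elem_var_x prime_elem_var_y by (auto simp: prime_elem_def)
  moreover have "homogeneous i (var_x ^ i)" "homogeneous j (var_y ^ j)"
    using homogeneous_power[OF homogeneous_var_x, of i] homogeneous_power[OF homogeneous_var_y, of j]
    by simp_all
  ultimately show ?thesis
    unfolding homogeneous_basis_iff
    by (auto simp: mem_D_mod_iff dvd_def mult.commute)
qed

lemma exponents_sym: "exponents K \<mu> d1 d2 \<Longrightarrow> exponents K \<mu> d2 d1"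
  unfolding exponents_def by (blast intro: homogeneous_basis_swap)

text \<open>Modulo \<open>x + y\<close>, the quotients of \<open>a1 + b1\<close> and
  \<open>a2 + b2\<close> by \<open>(x + y) ^ k\<close> become monomials in \<open>x\<close>. If the
  first is nonzero, a multiple of it cancels the second since \<open>d1 \<le> d2\<close>; if it is
  zero, the second is not, and the roles are exchanged.\<close>

lemma exponents_step:
  assumes "exponents TYPE('a::field) (i, j, k) d1 d2" "d1 \<le> d2"
  shows "exponents TYPE('a) (i, j, Suc k) (Suc d1) d2 \<or> exponents TYPE('a) (i, j, Suc k) d1 (Suc d2)"
proof -
  let ?l = "var_x + var_y :: 'a poly poly"
  obtain a1 b1 a2 b2 :: "'a poly poly" where B: "homogeneous_basis (i, j, k) d1 (a1, b1) d2 (a2, b2)"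
    using assms(1) by (auto simp: exponents_def)
  note B' = homogeneous_basisD[OF B]
  have l0: "?l \<noteq> 0" using prime_elem_var_x_plus_var_y by (auto simp: prime_elem_def)
  hence lk0: "?l ^ k \<noteq> 0" by (rule power_not_zero)
  have step: "exponents TYPE('a) (i, j, Suc k) (Suc e1) e2"
    if "homogeneous_basis (i, j, k) e1 (u1, v1) e2 (u2, v2)"
       "\<not> ?l ^ Suc k dvd u1 + v1" "?l ^ Suc k dvd u2 + v2" for e1 e2 u1 v1 u2 v2
    using homogeneous_basis_step[OF that] by (auto simp: exponents_def)
  show ?thesis
  proof (cases "?l ^ Suc k dvd a1 + b1")
    case True
    have "\<not> ?l ^ Suc k dvd a2 + b2"
    proof
      assume T2: "?l ^ Suc k dvd a2 + b2"
      \<comment> \<open>The value of this element on \<open>x + y\<close> is not divisible by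
        \<open>?l ^ Suc k\<close>, so it cannot be generated by two elements whose values
        are.\<close>
      have "(var_x ^ i * ?l ^ k, 0) \<in> D_mod (i, j, k)" by (simp add: mem_D_mod_iff)
      then obtain f h where "var_x ^ i * ?l ^ k = f * a1 + h * a2" "0 = f * b1 + h * b2"
        unfolding B'(6) by blast
      hence "?l ^ k * var_x ^ i = f * (a1 + b1) + h * (a2 + b2)" by (simp add: algebra_simps)
      hence "?l ^ k * ?l dvd ?l ^ k * var_x ^ i" using True T2 by (simp add: mult.commute)
      hence "?l dvd var_x ^ i" using l0 by (metis dvd_times_left_cancel_iff power_not_zero)
      thus False by (simp add: var_x_plus_var_y_dvd_iff var_x_power_eq_monom)
    qed
    thus ?thesis using step[OF homogeneous_basis_swap[OF B]] True exponents_sym by blast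
  next
    case False
    have "?l ^ k dvd a1 + b1" "?l ^ k dvd a2 + b2" using B'(8,9) by (simp_all only: mem_D_mod_iff)
    then obtain f1 f2 where f: "a1 + b1 = f1 * ?l ^ k" "a2 + b2 = f2 * ?l ^ k"
      by (metis dvdE mult.commute)
    have hl: "homogeneous k (?l ^ k)"
      using homogeneous_power[OF homogeneous_var_x_plus_var_y, of k] by simp
    have hs: "homogeneous d1 (f1 * ?l ^ k)" "homogeneous d2 (f2 * ?l ^ k)"
      unfolding f[symmetric] by (intro homogeneous_add B'(1-4))+
    have dvd_iff: "?l ^ Suc k dvd u * ?l ^ k \<longleftrightarrow> poly u [:0, -1:] = 0" for u
      using lk0 unfolding power_Suc var_x_plus_var_y_dvd_iff[symmetric] by (rule dvd_times_right_cancel_iff)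
    have nz: "f1 * ?l ^ k \<noteq> 0" using False f(1) by auto
    note q1 = homogeneous_quotient[OF hl hs(1) nz]
    obtain c1 where c1: "poly f1 [:0, -1:] = monom c1 (d1 - k)"
      using homogeneous_poly_antidiagonal[OF q1(2)] by blast
    have "c1 \<noteq> 0" using False c1 f(1) dvd_iff[of f1] by auto
    have "\<exists>c2. poly f2 [:0, -1:] = monom c2 (d2 - k)"
    \<comment> \<open>The zero case is separate because \<open>homogeneous_quotient\<close> requires
      a nonzero product.\<close>
    proof (cases "f2 = 0")
      case True thus ?thesis by (auto intro: exI[of _ 0])
    next
      case False
      thus ?thesis using homogeneous_poly_antidiagonal[OF homogeneous_quotient(2)[OF hl hs(2)]] lk0 by simp
    qed
    then obtain c2 where c2: "poly f2 [:0, -1:] = monom c2 (d2 - k)" ..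
    \<comment> \<open>Coefficient and degree of this power of \<open>x\<close> are those that cancel
      the residue of \<open>f2\<close> against that of \<open>f1\<close>.\<close>
    define c where "c = [:monom (- c2 / c1) (d2 - d1):]"
    have hc: "homogeneous (d2 - d1) c"
      by (auto simp: c_def homogeneous_def coeff_pCons split: nat.splits if_splits)
    have d2: "d2 = d1 + (d2 - d1)" using assms(2) by simp
    have "homogeneous_basis (i, j, k) d1 (a1, b1) (d1 + (d2 - d1)) (a2 + c * a1, b2 + c * b1)"
      using B hc by (intro homogeneous_basis_shear) (simp_all flip: d2)
    moreover have "a2 + c * a1 + (b2 + c * b1) = (f2 + c * f1) * ?l ^ k"
      unfolding distrib_right f[symmetric] mult.assoc by (simp add: algebra_simps)
    moreover have "poly (f2 + c * f1) [:0, -1:] = 0"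
    proof -
      have "poly (f2 + c * f1) [:0, -1:]
          = monom c2 (d2 - k) + monom (- c2 / c1) (d2 - d1) * monom c1 (d1 - k)"
        by (simp add: c1 c2 c_def)
      also have "\<dots> = 0"
        using \<open>c1 \<noteq> 0\<close> q1(1) assms(2) by (simp add: mult_monom add_monom)
      finally show ?thesis .
    qed
    ultimately show ?thesis
      using step[of d1 a1 b1 "d1 + (d2 - d1)" "a2 + c * a1" "b2 + c * b1"] False dvd_iff
      unfolding d2[symmetric] by metis
  qed
qed

text \<open>Each step raises one of the two degrees by one; \<open>min\<close> and
  \<open>max\<close> restore the order that \<open>exponents_step\<close> requires.\<close>

lemma exponents_exist: "\<exists>d1 d2. d1 \<le> d2 \<and> d1 + d2 = i + j + k \<and> exponents TYPE('a::field) (i, j, k) d1 d2"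
proof (induction k)
  case 0
  have "exponents TYPE('a) (i, j, 0) i j"
    unfolding exponents_def by (blast intro: homogeneous_basis_0)
  hence "exponents TYPE('a) (i, j, 0) (min i j) (max i j)"
    using exponents_sym by (auto simp: min_def max_def)
  thus ?case by (intro exI[of _ "min i j"] exI[of _ "max i j"]) (simp add: min_def)
next
  case (Suc k)
  then obtain d1 d2 where d: "d1 \<le> d2" "d1 + d2 = i + j + k" "exponents TYPE('a) (i, j, k) d1 d2" by blast
  have "\<exists>e1 e2. e1 + e2 = i + j + Suc k \<and> exponents TYPE('a) (i, j, Suc k) e1 e2"
    using exponents_step[OF d(3,1)] d(2) by (metis add_Suc add_Suc_right)
  then obtain e1 e2 where "e1 + e2 = i + j + Suc k" "exponents TYPE('a) (i, j, Suc k) e1 e2" by blast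
  hence "exponents TYPE('a) (i, j, Suc k) (min e1 e2) (max e1 e2)"
    using exponents_sym by (auto simp: min_def max_def)
  thus ?case using \<open>e1 + e2 = _\<close> by (intro exI[of _ "min e1 e2"] exI[of _ "max e1 e2"]) (simp add: min_def)
qed

section \<open>Uniqueness of the exponents\<close>

text \<open>Taking components of degree \<open>d < d2\<close> removes the second basis element. The
  last clause treats \<open>d < d1\<close> explicitly, because \<open>d - d1\<close> then truncates
  to zero.\<close>

lemma low_degree_multiple:
  assumes "homogeneous_basis \<mu> d1 (a1, b1) d2 (a2, b2)"
    and "homogeneous d a" "homogeneous d b" "(a, b) \<in> D_mod \<mu>" "d < d2"
  obtains f where "a = f * a1" "b = f * b1" "homogeneous (d - d1) f" "d < d1 \<longrightarrow> f = 0"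
proof -
  note B = homogeneous_basisD[OF assms(1)]
  obtain f h where fh: "a = f * a1 + h * a2" "b = f * b1 + h * b2" using assms(4) unfolding B(6) by blast
  have "a = homogeneous_part d a" "b = homogeneous_part d b" using assms(2,3) by (simp_all add: homogeneous_part_homogeneous)
  hence eq: "a = homogeneous_part d (f * a1)" "b = homogeneous_part d (f * b1)"
    using homogeneous_part_mult_less[OF B(3) assms(5), of h] homogeneous_part_mult_less[OF B(4) assms(5), of h]
    by (simp_all only: fh homogeneous_part_add add_0_right)
  show thesis
  proof (cases "d < d1")
    case True
    have "a = 0" "b = 0"
      using eq homogeneous_part_mult_less[OF B(1) True, of f] homogeneous_part_mult_less[OF B(2) True, of f] by simp_all
    thus thesis by (intro that[of 0]) simp_all
  next
    case False
    hence "homogeneous_part d (f * a1) = homogeneous_part (d - d1) f * a1" "homogeneous_part d (f * b1) = homogeneous_part (d - d1) f * b1"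
      using homogeneous_part_mult[OF B(1), of "d - d1" f] homogeneous_part_mult[OF B(2), of "d - d1" f] by simp_all
    thus thesis using eq False by (intro that[of "homogeneous_part (d - d1) f"]) (simp_all add: homogeneous_homogeneous_part)
  qed
qed

text \<open>Below \<open>e1\<close> the module has no nonzero homogeneous element, and below
  \<open>e2\<close> its homogeneous elements are all multiples of a single one, which would make the
  other basis dependent.\<close>

lemma exponents_le:
  assumes "exponents (K :: 'a::field itself) \<mu> d1 d2" "d1 \<le> d2" "exponents K \<mu> e1 e2" "e1 \<le> e2"
  shows "e1 \<le> d1 \<and> e2 \<le> d2"
proof -
  obtain a1 b1 a2 b2 :: "'a poly poly" where A: "homogeneous_basis \<mu> d1 (a1, b1) d2 (a2, b2)"
    using assms(1) by (auto simp: exponents_def)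
  obtain u1 v1 u2 v2 :: "'a poly poly" where U: "homogeneous_basis \<mu> e1 (u1, v1) e2 (u2, v2)"
    using assms(3) by (auto simp: exponents_def)
  note A' = homogeneous_basisD[OF A]
  have nz: "\<not> (a1 = 0 \<and> b1 = 0)" using A'(5)[of 1 0] by auto
  have "e1 \<le> d1"
  proof (rule ccontr)
    assume "\<not> e1 \<le> d1"
    then obtain f where "a1 = f * u1" "b1 = f * v1" "f = 0"
      using low_degree_multiple[OF U A'(1,2,8)] assms(4) by (metis leI order_less_le_trans)
    thus False using nz by simp
  qed
  moreover have "e2 \<le> d2"
  proof (rule ccontr)
    assume "\<not> e2 \<le> d2"
    hence lt: "d1 < e2" "d2 < e2" using assms(2) by auto
    obtain f where f: "a1 = f * u1" "b1 = f * v1" using low_degree_multiple[OF U A'(1,2,8) lt(1)] by metis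
    obtain h where h: "a2 = h * u1" "b2 = h * v1" using low_degree_multiple[OF U A'(3,4,9) lt(2)] by metis
    \<comment> \<open>Two multiples of the same element satisfy this cross relation.\<close>
    have "h * a1 + (- f) * a2 = 0" "h * b1 + (- f) * b2 = 0" by (simp_all add: f h)
    hence "f = 0" using A'(5)[of h "- f"] by simp
    thus False using nz f by simp
  qed
  ultimately show ?thesis ..
qed

text \<open>\<open>exponents_le\<close>, used in both directions, shows that the description in
  \<open>\<Delta>_def\<close> has a unique solution.\<close>

lemma \<Delta>_eq:
  assumes "exponents K \<mu> d1 d2"
  shows "int (\<Delta> K \<mu>) = \<bar>int d1 - int d2\<bar>"
proof -
  have ordered: "exponents K \<mu> (min e1 e2) (max e1 e2)"
    "\<bar>int e1 - int e2\<bar> = int (max e1 e2) - int (min e1 e2)"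
    if "exponents K \<mu> e1 e2" for e1 e2
    using that exponents_sym[OF that] by (auto simp: min_def max_def)
  have uniq: "\<bar>int e1 - int e2\<bar> = \<bar>int f1 - int f2\<bar>"
    if e: "exponents K \<mu> e1 e2" and f: "exponents K \<mu> f1 f2" for e1 e2 f1 f2
  proof -
    have le: "min c d \<le> max c d" for c d :: nat by simp
    show ?thesis
      using exponents_le[OF ordered(1)[OF e] le ordered(1)[OF f] le]
        exponents_le[OF ordered(1)[OF f] le ordered(1)[OF e] le] ordered(2)[OF e] ordered(2)[OF f]
      by linarith
  qed
  have "\<Delta> K \<mu> = nat \<bar>int d1 - int d2\<bar>"
    unfolding \<Delta>_def
  proof (rule the_equality)
    show "\<exists>e1 e2. exponents K \<mu> e1 e2 \<and> int (nat \<bar>int d1 - int d2\<bar>) = \<bar>int e1 - int e2\<bar>"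
      using assms by auto
    fix \<delta> assume "\<exists>e1 e2. exponents K \<mu> e1 e2 \<and> int \<delta> = \<bar>int e1 - int e2\<bar>"
    then obtain e1 e2 where "exponents K \<mu> e1 e2" "int \<delta> = \<bar>int e1 - int e2\<bar>" by blast
    thus "\<delta> = nat \<bar>int d1 - int d2\<bar>" using uniq[OF _ assms] by (metis nat_int)
  qed
  thus ?thesis by simp
qed

section \<open>Splittings of a power of \<open>x + y\<close>\<close>

lemma prime_elem_power_dvd_mult_cancel:
  fixes p :: "'a::idom"
  assumes "prime_elem p" "\<not> p dvd u" "p ^ n dvd u * v"
  shows "p ^ n dvd v"
  using assms(3)
proof (induction n arbitrary: v)
  case (Suc n)
  have p0: "p \<noteq> 0" using assms(1) by (auto simp: prime_elem_def)
  have "p dvd u * v" using Suc.prems by (auto dest: dvd_mult_left)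
  hence "p dvd v" using assms(1,2) by (simp add: prime_elem_dvd_mult_iff)
  then obtain w where w: "v = p * w" by (rule dvdE)
  have "p * p ^ n dvd p * (u * w)" using Suc.prems w by (simp add: mult_ac)
  hence "p ^ n dvd u * w" using p0 by (metis dvd_times_left_cancel_iff)
  hence "p ^ n dvd w" by (rule Suc.IH)
  thus ?case using w by (simp add: mult_dvd_mono)
qed simp

text \<open>Factors \<open>p\<close> are stripped off one at a time. Used for each linear form in
  turn, this shows that a divisor of a product of their powers is a unit if none of them divides
  it.\<close>

lemma dvd_prime_elem_power_mult:
  fixes p :: "'a::idom"
  assumes "prime_elem p" "f dvd p ^ n * u"
  shows "p dvd f \<or> f dvd u"
  using assms(2)
proof (induction n)
  case (Suc n)
  have p0: "p \<noteq> 0" using assms(1) by (auto simp: prime_elem_def)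
  obtain h where h: "p * (p ^ n * u) = f * h" using Suc.prems unfolding power_Suc mult.assoc by (rule dvdE)
  hence "p dvd f * h" by (metis dvd_triv_left)
  hence "p dvd f \<or> p dvd h" using assms(1) by (simp add: prime_elem_dvd_mult_iff)
  thus ?case
  proof
    assume "p dvd h"
    then obtain h' where "h = p * h'" by (rule dvdE)
    hence "p * (p ^ n * u) = p * (f * h')" using h by (simp add: mult_ac)
    hence "p ^ n * u = f * h'" using p0 by (metis mult_left_cancel)
    thus ?case using Suc.IH by simp
  qed simp
qed simp

lemma homogeneous_unit_degree:
  assumes "homogeneous d f" "f dvd 1" shows "d = 0"
proof -
  obtain c where c: "f = [:c:]" "c dvd 1" using assms(2) unfolding is_unit_poly_iff by blast
  then obtain c' where "c = [:c':]" "c' dvd 1" unfolding is_unit_poly_iff by blast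
  hence "coeff (coeff f 0) 0 \<noteq> 0" using c by auto
  thus ?thesis using assms(1) by (auto simp: homogeneous_def)
qed

lemma var_not_dvd:
  "\<not> var_x dvd (var_y :: 'a::field poly poly)" "\<not> var_y dvd (var_x :: 'a poly poly)"
  "\<not> var_x dvd (var_x + var_y :: 'a poly poly)" "\<not> var_y dvd (var_x + var_y :: 'a poly poly)"
  "\<not> var_x + var_y dvd (var_x :: 'a poly poly)" "\<not> var_x + var_y dvd (var_y :: 'a poly poly)"
proof -
  show 1: "\<not> var_x dvd (var_y :: 'a poly poly)"
    using coeff_var_x_power_dvd[of 1 "var_y :: 'a poly poly" 0 1] by (auto simp: var_y_def)
  show 2: "\<not> var_y dvd (var_x :: 'a poly poly)"
    using coeff_var_y_power_dvd[of 1 "var_x :: 'a poly poly" 0] by (auto simp: var_x_def)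
  show "\<not> var_x dvd (var_x + var_y :: 'a poly poly)" "\<not> var_y dvd (var_x + var_y :: 'a poly poly)"
    using 1 2 by (simp_all add: dvd_add_right_iff dvd_add_left_iff)
  show "\<not> var_x + var_y dvd (var_x :: 'a poly poly)" "\<not> var_x + var_y dvd (var_y :: 'a poly poly)"
    unfolding var_x_plus_var_y_dvd_iff by (simp_all add: var_x_def var_y_def)
qed

text \<open>
  The pair \<open>(a, b)\<close> is the basis element of degree \<open>m\<close> at the center \<open>(g, g', m)\<close>; the other one,
  of degree \<open>m + q\<close>, is \<open>x ^ g y ^ g' (\<partial>\<^sub>y - \<partial>\<^sub>x)\<close>.
\<close>

locale gap_splitting =
  fixes a b :: "'a::field poly poly" and g g' m q :: nat
  assumes sum: "a + b = (var_x + var_y) ^ m"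
    and hom: "homogeneous m a" "homogeneous m b"
    and dvd: "var_x ^ g dvd a" "var_y ^ g' dvd b"
    and exact: "\<not> var_x ^ Suc g dvd a" "\<not> var_y ^ Suc g' dvd b"
    and not_dvd: "\<not> var_y dvd a" "\<not> var_x dvd b" "\<not> var_x + var_y dvd a"
    and size: "g + g' = m + q"
begin

context
  fixes r s t i j k :: nat
  assumes r: "r = i - g" and s: "s = j - g'" and t: "t = k - m"
begin

text \<open>\<open>r\<close>, \<open>s\<close>, \<open>t\<close> are truncated differences: where
  the multiplicity exceeds the center, the factor supplies the missing power; elsewhere it is 1,
  since the divisibility already holds.\<close>

lemma shifted_mem_D_mod:
  "(var_x ^ r * var_y ^ s * (var_x + var_y) ^ t * a,
    var_x ^ r * var_y ^ s * (var_x + var_y) ^ t * b) \<in> D_mod (i, j, k)"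
proof -
  let ?l = "var_x + var_y :: 'a poly poly" and ?P = "var_x ^ r * var_y ^ s * (var_x + var_y) ^ t :: 'a poly poly"
  have pow: "v ^ n dvd v ^ (n - n') * w" if "v ^ n' dvd w" for v w :: "'a poly poly" and n n'
  proof -
    have "v ^ n dvd v ^ (n - n' + n')" by (rule le_imp_power_dvd) simp
    also have "\<dots> dvd v ^ (n - n') * w" unfolding power_add by (rule mult_dvd_mono[OF dvd_refl that])
    finally show ?thesis .
  qed
  have "var_x ^ i dvd var_x ^ r * a" "var_y ^ j dvd var_y ^ s * b" "?l ^ k dvd ?l ^ t * (a + b)"
    unfolding r s t by (intro pow dvd, intro pow dvd, intro pow) (simp add: sum)
  hence "var_x ^ i dvd var_x ^ r * a * (var_y ^ s * ?l ^ t)"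
    "var_y ^ j dvd var_y ^ s * b * (var_x ^ r * ?l ^ t)"
    "?l ^ k dvd ?l ^ t * (a + b) * (var_x ^ r * var_y ^ s)"
    by (blast intro: dvd_mult2)+
  moreover have "?P * a = var_x ^ r * a * (var_y ^ s * ?l ^ t)"
    "?P * b = var_y ^ s * b * (var_x ^ r * ?l ^ t)"
    "?P * a + ?P * b = ?l ^ t * (a + b) * (var_x ^ r * var_y ^ s)"
    unfolding distrib_left[symmetric] by (simp_all only: mult_ac)
  ultimately show ?thesis unfolding mem_D_mod_iff by presburger
qed

text \<open>\<open>f\<close> divides a product of powers of the three forms, so it is a unit once
  none of them divides it. A form dividing \<open>f\<close> contradicts \<open>not_dvd\<close> if
  its exponent in the factor is zero; otherwise it forces one power too many into \<open>a\<close>,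
  \<open>b\<close> or \<open>(x + y) ^ m\<close>.\<close>

lemma shifted_primitive:
  assumes A: "var_x ^ r * var_y ^ s * (var_x + var_y) ^ t * a = f * a1"
    and B: "var_x ^ r * var_y ^ s * (var_x + var_y) ^ t * b = f * b1"
    and D: "(a1, b1) \<in> D_mod (i, j, k)"
  shows "f dvd 1"
proof -
  let ?x = "var_x :: 'a poly poly" and ?y = "var_y :: 'a poly poly" and ?l = "var_x + var_y :: 'a poly poly"
  note px = prime_elem_var_x[where 'a = 'a] and py = prime_elem_var_y[where 'a = 'a]
    and pl = prime_elem_var_x_plus_var_y[where 'a = 'a]
  have "(f * a1) + (f * b1) = ?x ^ r * (?y ^ s * (?l ^ (t + m) * 1))"
    unfolding A[symmetric] B[symmetric] distrib_left[symmetric] sum by (simp only: power_add mult_ac mult_1_left mult_1_right)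
  hence sum_eq: "f * (a1 + b1) = ?x ^ r * (?y ^ s * (?l ^ (t + m) * 1))" by (simp only: distrib_left)
  have notpow: "\<not> p dvd u ^ n" if "prime_elem p" "\<not> p dvd u" for p u :: "'a poly poly" and n
    using that prime_elem_dvd_power by blast
  have D': "?x ^ i dvd a1" "?y ^ j dvd b1" "?l ^ k dvd a1 + b1" using D by (simp_all only: mem_D_mod_iff)
  have nx: "\<not> ?x dvd ?y ^ s * ?l ^ t" and ny: "\<not> ?y dvd ?x ^ r * ?l ^ t" and nl: "\<not> ?l dvd ?x ^ r * ?y ^ s"
    by (simp_all add: prime_elem_dvd_mult_iff px py pl notpow var_not_dvd)
  have "\<not> ?x dvd f"
  proof
    assume f: "?x dvd f"
    show False
    proof (cases "r = 0")
      case True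
      have "?x dvd (?y ^ s * ?l ^ t) * b" using f B True by (simp add: mult.assoc)
      thus False using nx not_dvd(2) by (simp add: prime_elem_dvd_mult_iff px)
    next
      case False
      \<comment> \<open>As \<open>r\<close> is positive, the difference is not truncated:
        \<open>?x dvd f\<close> and \<open>?x ^ i dvd a1\<close> give a power of \<open>?x\<close>
        that is one too high for \<open>a\<close>.\<close>
      hence i: "Suc i = r + Suc g" using r by simp
      have "?x ^ r * ?x ^ Suc g dvd f * a1"
        using mult_dvd_mono[OF f D'(1)] by (simp only: i flip: power_add power_Suc)
      hence "?x ^ r * ?x ^ Suc g dvd ?x ^ r * ((?y ^ s * ?l ^ t) * a)" unfolding A[symmetric] by (simp only: mult_ac)
      hence "?x ^ Suc g dvd (?y ^ s * ?l ^ t) * a" using px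
        by (metis dvd_times_left_cancel_iff power_not_zero prime_elem_not_zeroI)
      thus False using prime_elem_power_dvd_mult_cancel[OF px nx] exact(1) by blast
    qed
  qed
  moreover have "\<not> ?y dvd f"
  proof
    assume f: "?y dvd f"
    show False
    proof (cases "s = 0")
      case True
      have "?y dvd (?x ^ r * ?l ^ t) * a" using f A True by (simp add: mult.assoc)
      thus False using ny not_dvd(1) by (simp add: prime_elem_dvd_mult_iff py)
    next
      case False
      hence j: "Suc j = s + Suc g'" using s by simp
      have "?y ^ s * ?y ^ Suc g' dvd f * b1"
        using mult_dvd_mono[OF f D'(2)] by (simp only: j flip: power_add power_Suc)
      hence "?y ^ s * ?y ^ Suc g' dvd ?y ^ s * ((?x ^ r * ?l ^ t) * b)" unfolding B[symmetric] by (simp only: mult_ac)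
      hence "?y ^ Suc g' dvd (?x ^ r * ?l ^ t) * b" using py
        by (metis dvd_times_left_cancel_iff power_not_zero prime_elem_not_zeroI)
      thus False using prime_elem_power_dvd_mult_cancel[OF py ny] exact(2) by blast
    qed
  qed
  moreover have "\<not> ?l dvd f"
  proof
    assume f: "?l dvd f"
    show False
    proof (cases "t = 0")
      case True
      have "?l dvd (?x ^ r * ?y ^ s) * a" using f A True by simp
      thus False using nl not_dvd(3) by (simp add: prime_elem_dvd_mult_iff pl)
    next
      case False
      hence k: "Suc k = (t + m) + 1" using t by simp
      have "?l ^ (t + m) * ?l ^ 1 dvd f * (a1 + b1)"
        using mult_dvd_mono[OF f D'(3)] by (simp only: k flip: power_add power_Suc)
      hence "?l ^ (t + m) * ?l ^ 1 dvd ?l ^ (t + m) * (?x ^ r * ?y ^ s)" unfolding sum_eq by (simp only: mult_ac mult_1_right mult_1_left)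
      hence "?l ^ 1 dvd ?x ^ r * ?y ^ s" using pl
        by (metis dvd_times_left_cancel_iff power_not_zero prime_elem_not_zeroI)
      thus False using nl by simp
    qed
  qed
  moreover have "f dvd ?x ^ r * (?y ^ s * (?l ^ (t + m) * 1))" unfolding sum_eq[symmetric] by simp
  ultimately show ?thesis
    using dvd_prime_elem_power_mult[OF px] dvd_prime_elem_power_mult[OF py] dvd_prime_elem_power_mult[OF pl] by blast
qed

end

lemma \<Delta>_within_ball:
  assumes "mult_dist \<mu> (g, g', m) \<le> int q"
  shows "int (\<Delta> TYPE('a) \<mu>) = int q - mult_dist \<mu> (g, g', m)"
proof -
  obtain i j k where \<mu>: "\<mu> = (i, j, k)" by (cases \<mu>)
  define r s t where rst: "r = i - g" "s = j - g'" "t = k - m"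
  define e where "e = r + s + t + m"
  define P :: "'a poly poly" where "P = var_x ^ r * var_y ^ s * (var_x + var_y) ^ t"
  obtain d1 d2 where d: "d1 \<le> d2" "d1 + d2 = i + j + k" "exponents TYPE('a) (i, j, k) d1 d2"
    using exponents_exist by blast
  have \<Delta>: "int (\<Delta> TYPE('a) \<mu>) = int d2 - int d1" using \<Delta>_eq[OF d(3)] d(1) \<mu> by simp
  \<comment> \<open>In each coordinate the distance is twice the truncated difference minus the
    signed one; \<open>size\<close> turns the sum into this identity.\<close>
  have dist: "2 * int e + int q - mult_dist \<mu> (g, g', m) = int i + int j + int k"
    using size unfolding \<mu> e_def rst mult_dist_def by simp
  show ?thesis
  proof (cases "d2 \<le> e")
    \<comment> \<open>Here \<open>d1 + d2 \<le> 2 * e\<close>, so the distance is at least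
      \<open>q\<close>; hence it equals \<open>q\<close> and both exponents are
      \<open>e\<close>.\<close>
    case True
    thus ?thesis using d(1,2) dist assms \<Delta> by linarith
  next
    case False
    obtain a1 b1 a2 b2 :: "'a poly poly" where basis: "homogeneous_basis (i, j, k) d1 (a1, b1) d2 (a2, b2)"
      using d(3) by (auto simp: exponents_def)
    have "homogeneous (r + s + t) P"
      unfolding P_def
      using homogeneous_mult[OF homogeneous_monomial homogeneous_power[OF homogeneous_var_x_plus_var_y, of t]] by simp
    hence homP: "homogeneous e (P * a)" "homogeneous e (P * b)"
      unfolding e_def by (auto intro: homogeneous_mult hom)
    have mem: "(P * a, P * b) \<in> D_mod (i, j, k)"
      unfolding P_def by (rule shifted_mem_D_mod[OF rst])
    have "e < d2" using False by simp
    then obtain f where f: "P * a = f * a1" "P * b = f * b1" "homogeneous (e - d1) f" "e < d1 \<longrightarrow> f = 0"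
      using low_degree_multiple[OF basis homP mem] by blast
    have "f dvd 1"
      using shifted_primitive[OF rst f(1,2)[unfolded P_def] homogeneous_basisD(8)[OF basis]] .
    hence "e - d1 = 0" "f \<noteq> 0" using homogeneous_unit_degree[OF f(3)] by auto
    \<comment> \<open>Truncated subtraction leaves the case \<open>e < d1\<close> open; it is
      excluded because \<open>f\<close> is nonzero.\<close>
    hence "d1 = e" using f(4) by auto
    thus ?thesis using d(2) dist \<Delta> by linarith
  qed
qed

end

section \<open>Binomial coefficients modulo a prime\<close>

text \<open>Pascal's rule makes the sum telescope, by induction downwards from \<open>g = m\<close>.
  It serves to evaluate the part \<open>a\<close> of the splitting at \<open>y = -x\<close>.\<close>

lemma sum_alternating_binomial_tail:
  assumes "0 < g" "g \<le> m"
  shows "(\<Sum>i=g..m. (-1) ^ (m - i) * of_nat (m choose i))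
    = (-1) ^ (m - g) * (of_nat ((m - 1) choose (g - 1)) :: 'a::comm_ring_1)"
  using assms(2,1)
proof (induction rule: inc_induct)
  case base
  thus ?case by simp
next
  case (step n)
  have choose: "m choose n = (m - 1 choose n) + (m - 1 choose (n - 1))"
    using step.prems step.hyps by (cases m; cases n) simp_all
  have sign: "(-1) ^ (m - n) = - ((-1) ^ (m - Suc n) :: 'a)"
    using step.hyps Suc_diff_Suc[of n m] by (metis mult_minus1 power_Suc)
  have "(\<Sum>i=n..m. (-1) ^ (m - i) * of_nat (m choose i) :: 'a)
      = (-1) ^ (m - n) * of_nat (m choose n) + (\<Sum>i=Suc n..m. (-1) ^ (m - i) * of_nat (m choose i))"
    using step.hyps by (intro sum.atLeast_Suc_atMost) simp
  also have "(\<Sum>i=Suc n..m. (-1) ^ (m - i) * of_nat (m choose i))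
      = (-1) ^ (m - Suc n) * (of_nat ((m - 1) choose n) :: 'a)"
    using step.IH by simp
  finally show ?case by (simp add: choose sign algebra_simps)
qed

text \<open>These are the coefficients in
  \<open>(1 + X) ^ (p + n) = (1 + X ^ p) * (1 + X) ^ n\<close> modulo \<open>p\<close>:
  Vandermonde's sum keeps only the indices 0 and \<open>p\<close>.\<close>

lemma choose_add_prime_cong:
  assumes "prime p"
  shows "[(p + n) choose k = (n choose k) + (if p \<le> k then n choose (k - p) else 0)] (mod p)"
proof -
  let ?f = "\<lambda>i. (p choose i) * (n choose (k - i))"
  have p: "p > 0" using assms by (simp add: prime_gt_0_nat)
  have "(p + n) choose k = (\<Sum>i\<le>k. ?f i)" by (rule vandermonde[symmetric])
  also have "[(\<Sum>i\<le>k. ?f i) = (\<Sum>i\<le>k. if i = 0 then n choose k else if i = p then n choose (k - p) else 0)] (mod p)"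
  proof (intro cong_sum)
    fix i
    have "p dvd p choose i" if "i \<noteq> 0" "i \<noteq> p"
      using that dvd_choose_prime[of i p] assms by (cases "i < p") (auto simp: binomial_eq_0)
    thus "[?f i = (if i = 0 then n choose k else if i = p then n choose (k - p) else 0)] (mod p)"
      by (auto simp: cong_0_iff)
  qed
  also have "(\<Sum>i\<le>k. if i = 0 then n choose k else if i = p then n choose (k - p) else 0)
      = (\<Sum>i\<le>k. if i = 0 then n choose k else 0) + (\<Sum>i\<le>k. if i = p then n choose (k - p) else 0)"
    unfolding sum.distrib[symmetric] using p by (intro sum.cong) auto
  also have "\<dots> = (n choose k) + (if p \<le> k then n choose (k - p) else 0)" by simp
  finally show ?thesis .
qed

text \<open>One digit of Lucas's theorem. Induction on \<open>m\<close> adds \<open>p\<close> to the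
  upper index, and Pascal's rule recombines the two resulting terms.\<close>

lemma lucas_step:
  assumes "prime p" "r < p" "t < p"
  shows "[(p * m + r) choose (p * i + t) = (m choose i) * (r choose t)] (mod p)"
proof (induction m arbitrary: i)
  case 0
  show ?case
  proof (cases i)
    case (Suc i')
    hence "r < p * i + t" using assms by simp
    thus ?thesis using Suc by (simp add: binomial_eq_0)
  qed simp
next
  case (Suc m)
  let ?a = "if p \<le> p * i + t then (p * m + r) choose (p * i + t - p) else 0"
  let ?b = "if i = 0 then 0 else m choose (i - 1)"
  have "[(p * Suc m + r) choose (p * i + t)
      = ((p * m + r) choose (p * i + t)) + (if p \<le> p * i + t then (p * m + r) choose (p * i + t - p) else 0)] (mod p)"
    using choose_add_prime_cong[OF assms(1), of "p * m + r" "p * i + t"] by (simp add: add.assoc)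
  moreover have "[?a = ?b * (r choose t)] (mod p)"
  proof (cases i)
    case (Suc i')
    hence "p * i + t - p = p * i' + t" by simp
    thus ?thesis using Suc Suc.IH[of i'] by simp
  qed (use assms in simp)
  hence "[((p * m + r) choose (p * i + t)) + ?a = (m choose i) * (r choose t) + ?b * (r choose t)] (mod p)"
    by (intro cong_add Suc.IH)
  moreover have "(m choose i) * (r choose t) + ?b * (r choose t) = (Suc m choose i) * (r choose t)"
    by (cases i) (simp_all add: algebra_simps)
  ultimately show ?case by (metis (no_types, lifting) cong_trans)
qed

section \<open>Digit sets and nonvanishing binomial coefficients\<close>

lemma digit_0: "digit p 0 n = n mod p"
  by (simp add: digit_def)

lemma digit_Suc: "digit p (Suc e) n = digit p e (n div p)"
  by (simp add: digit_def div_mult2_eq)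

lemma mem_G_set_iff_div_mod:
  "g \<in> G_set p m \<longleftrightarrow> g mod p \<le> m mod p \<and> g div p \<in> G_set p (m div p)"
proof -
  have "(\<forall>e. digit p e g \<le> digit p e m) \<longleftrightarrow>
      digit p 0 g \<le> digit p 0 m \<and> (\<forall>e. digit p (Suc e) g \<le> digit p (Suc e) m)"
    by (metis not0_implies_Suc)
  thus ?thesis by (simp add: G_set_def digit_0 digit_Suc)
qed

text \<open>Lucas's theorem: one step splits off the last digits, and induction treats
  \<open>g div p\<close> and \<open>m div p\<close>.\<close>

lemma mem_G_set_iff:
  assumes "prime p"
  shows "g \<in> G_set p m \<longleftrightarrow> \<not> p dvd (m choose g)"
proof (induction g arbitrary: m rule: less_induct)
  case (less g)
  have p: "p > 1" using assms by (rule prime_gt_1_nat)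
  show ?case
  proof (cases "g = 0")
    case True
    thus ?thesis using p by (simp add: G_set_def digit_def)
  next
    case False
    have "[(p * (m div p) + m mod p) choose (p * (g div p) + g mod p)
        = (m div p choose (g div p)) * (m mod p choose (g mod p))] (mod p)"
      using p by (intro lucas_step assms) auto
    hence "p dvd (m choose g) \<longleftrightarrow> p dvd (m div p choose (g div p)) * (m mod p choose (g mod p))"
      by (simp add: cong_dvd_iff)
    also have "\<dots> \<longleftrightarrow> p dvd (m div p choose (g div p)) \<or> p dvd (m mod p choose (g mod p))"
      using assms by (simp add: prime_dvd_mult_iff)
    also have "p dvd (m mod p choose (g mod p)) \<longleftrightarrow> \<not> g mod p \<le> m mod p"
    proof
      assume "p dvd (m mod p choose (g mod p))"
      moreover have "\<not> p dvd (m mod p choose (g mod p))" if "g mod p \<le> m mod p"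
      proof
        assume "p dvd (m mod p choose (g mod p))"
        \<comment> \<open>The coefficient divides the factorial of a number below
          \<open>p\<close>.\<close>
        hence "p dvd fact (m mod p)" using binomial_fact_lemma[OF that] by (metis dvd_mult)
        hence "p \<le> m mod p" using assms by (simp add: prime_dvd_fact_iff)
        moreover have "m mod p < p" using p by simp
        ultimately show False by linarith
      qed
      ultimately show "\<not> g mod p \<le> m mod p" by blast
    qed (simp add: binomial_eq_0)
    finally show ?thesis
      using less.IH[of "g div p" "m div p"] False p mem_G_set_iff_div_mod[of g p m] by auto
  qed
qed

lemma G_set_le: "prime p \<Longrightarrow> g \<in> G_set p m \<Longrightarrow> g \<le> m"
  by (metis mem_G_set_iff binomial_eq_0 dvd_0_right leI)

lemma finite_G_set: "prime p \<Longrightarrow> finite (G_set p m)"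
  using G_set_le by (auto intro: finite_subset[of _ "{..m}"])

lemma diff_mem_G_set: "prime p \<Longrightarrow> g \<in> G_set p m \<Longrightarrow> m - g \<in> G_set p m"
  using G_set_le[of p g m] binomial_symmetric[of g m] by (simp add: mem_G_set_iff)

text \<open>Since \<open>g \<mapsto> m - g\<close> reverses \<open>G_set p m\<close>, the entry \<open>g'\<close> encodes the predecessor \<open>m - g'\<close> of \<open>g\<close>.\<close>

lemma S_set_predecessor:
  assumes "prime p" "(g, g', m) \<in> S_set p m"
  shows "g \<in> G_set p m" "g' \<le> m" "m - g' \<in> G_set p m" "m - g' < g"
    "\<And>k. m - g' < k \<Longrightarrow> k < g \<Longrightarrow> k \<notin> G_set p m"
proof -
  let ?G = "G_set p m"
  define L where "L = sorted_list_of_set ?G"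
  note fin = finite_G_set[OF assms(1), of m]
  have L: "sorted_wrt (<) L" "set L = ?G" "distinct L" "length L = card ?G"
    using fin by (simp_all add: L_def strict_sorted_list_of_set)
  obtain i where i: "1 \<le> i" "i \<le> card ?G - 1" "g = L ! i" "g' = L ! (card ?G - 1 - i + 1)"
    using assms(2) by (auto simp: S_set_def Let_def g_enum_def L_def)
  have len: "i < length L" using i L(4) by simp
  have le: "x \<in> set L \<Longrightarrow> x \<le> m" for x using G_set_le[OF assms(1)] L(2) by blast
  \<comment> \<open>The reflected list is again increasing with the same elements, so it is
    \<open>L\<close>; this yields \<open>g' = m - L ! (i - 1)\<close>.\<close>
  define L' where "L' = map (\<lambda>x. m - x) (rev L)"
  have "sorted_wrt (<) L'"
    unfolding L'_def sorted_wrt_map sorted_wrt_rev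
    using L(1) by (rule sorted_wrt_mono_rel[rotated]) (use le in fastforce)
  moreover have "set L' = ?G"
  proof -
    have "set L' = (\<lambda>x. m - x) ` ?G" by (simp add: L'_def L(2))
    also have "\<dots> = ?G"
    proof
      show "(\<lambda>x. m - x) ` ?G \<subseteq> ?G" using diff_mem_G_set[OF assms(1)] by auto
      show "?G \<subseteq> (\<lambda>x. m - x) ` ?G"
      proof
        fix x assume "x \<in> ?G"
        thus "x \<in> (\<lambda>x. m - x) ` ?G"
          using diff_mem_G_set[OF assms(1)] G_set_le[OF assms(1)] by (intro image_eqI[of _ _ "m - x"]) auto
      qed
    qed
    finally show ?thesis .
  qed
  ultimately have "L' = L" using L(1,2) by (metis strict_sorted_equal)
  \<comment> \<open>With \<open>t = card ?G - 1\<close>, reversing the list turns position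
    \<open>t - i + 1\<close> into position \<open>i - 1\<close>.\<close>
  have idx: "card ?G - 1 - i + 1 = length L - Suc (i - 1)" using i(1,2) L(4) by simp
  have "L' ! (length L - Suc (i - 1)) = m - rev L ! (length L - Suc (i - 1))"
    unfolding L'_def using len i(1) by (intro nth_map) simp
  also have "rev L ! (length L - Suc (i - 1)) = L ! (i - 1)"
    using len i(1) by (subst rev_nth) auto
  finally have "g' = m - L ! (i - 1)" using i(4) idx \<open>L' = L\<close> by simp
  moreover have pm: "L ! (i - 1) \<in> ?G" using len L(2) nth_mem[of "i - 1" L] by simp
  ultimately have g': "m - g' = L ! (i - 1)" using G_set_le[OF assms(1) pm] by simp
  show "g \<in> ?G" using i(3) len L(2) nth_mem by blast
  show "g' \<le> m" using \<open>g' = m - L ! (i - 1)\<close> by simp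
  show "m - g' \<in> ?G" unfolding g' by (rule pm)
  show "m - g' < g" unfolding g' i(3) using sorted_wrt_nth_less[OF L(1), of "i - 1" i] len i(1) by simp
  fix k assume k: "m - g' < k" "k < g"
  show "k \<notin> ?G"
  proof
    assume "k \<in> ?G"
    then obtain l where l: "l < length L" "k = L ! l" using L(2) by (metis in_set_conv_nth)
    have "sorted L" using L(1) by (rule strict_sorted_imp_sorted)
    hence "i - 1 < l" using k(1) l(2) g' len by (metis leI less_le_not_le sorted_nth_mono less_imp_diff_less)
    moreover have "l < i" using \<open>sorted L\<close> k(2) l i(3) by (metis leI less_le_not_le sorted_nth_mono)
    ultimately show False by simp
  qed
qed

section \<open>Exact powers of \<open>p\<close> and the length of a gap\<close>

lemma power_dvd_if_digits_0:
  assumes "p > 0" "\<And>e. e < s \<Longrightarrow> digit p e n = 0" shows "p ^ s dvd n"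
  using assms(2)
proof (induction s)
  case (Suc s)
  then obtain c where c: "n = p ^ s * c" by (auto elim: dvdE)
  have "c mod p = 0" using Suc.prems[of s] c assms(1) by (simp add: digit_def)
  thus ?case unfolding c power_Suc2 by (intro mult_dvd_mono) auto
qed simp

text \<open>This makes \<open>low_exp\<close> the \<open>p\<close>-adic valuation. The least
  position exists because the vanishing of all digits would make \<open>p ^ n\<close> divide
  \<open>n\<close>.\<close>

lemma low_exp_dvd:
  assumes "p > 1" "n > 0"
  shows "p ^ low_exp p n dvd n" "\<not> p ^ Suc (low_exp p n) dvd n"
proof -
  show "p ^ low_exp p n dvd n"
    using assms(1) not_less_Least unfolding low_exp_def by (intro power_dvd_if_digits_0) auto
  have "\<exists>e. digit p e n \<noteq> 0"
  proof (rule ccontr)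
    assume "\<not> ?thesis"
    hence "p ^ n dvd n" using assms(1) by (intro power_dvd_if_digits_0) auto
    hence "p ^ n \<le> n" using assms(2) by (rule dvd_imp_le)
    moreover have "2 ^ n \<le> p ^ n" using assms(1) by (intro power_mono) auto
    ultimately show False using less_exp[of n] by linarith
  qed
  hence nz: "digit p (low_exp p n) n \<noteq> 0" unfolding low_exp_def by (rule LeastI_ex)
  show "\<not> p ^ Suc (low_exp p n) dvd n"
  proof
    assume "p ^ Suc (low_exp p n) dvd n"
    then obtain c where "n = p ^ low_exp p n * (p * c)" by (auto elim!: dvdE simp: mult_ac)
    hence "n div p ^ low_exp p n = p * c" using assms(1) by (metis nonzero_mult_div_cancel_left not_gr_zero power_not_zero not_one_less_zero)
    thus False using nz by (simp add: digit_def)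
  qed
qed

lemma digit_mod_power: "e < s \<Longrightarrow> digit p e (n mod p ^ s) = digit p e n"
proof (cases "p = 0")
  case False
  assume "e < s"
  then obtain d where "s = e + Suc d" using less_imp_Suc_add by fastforce
  hence "p ^ s = p ^ e * (p * p ^ d)" by (simp add: power_add)
  hence "n = p ^ e * (p * (p ^ d * (n div p ^ s))) + n mod p ^ s"
    by (metis mult.assoc mult_div_mod_eq)
  hence "n div p ^ e = p * (p ^ d * (n div p ^ s)) + n mod p ^ s div p ^ e"
    using False by (metis div_mult_self4 power_not_zero)
  thus ?thesis by (simp add: digit_def)
qed (simp add: power_0_left)

lemma digit_div_power: "s \<le> e \<Longrightarrow> digit p e n = digit p (e - s) (n div p ^ s)"
  by (simp add: digit_def flip: div_mult2_eq power_add)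

text \<open>Otherwise the digits of \<open>m\<close> below position \<open>s\<close>, added to the
  predecessor \<open>g - p ^ s\<close>, give an element of \<open>G_set p m\<close> strictly inside
  the gap.\<close>

lemma low_exp_dvd_of_gap:
  assumes "p > 1" "g - p ^ s \<in> G_set p m" "p ^ s dvd g" "0 < g"
    and "\<And>k. g - p ^ s < k \<Longrightarrow> k < g \<Longrightarrow> k \<notin> G_set p m"
  shows "p ^ s dvd m"
proof (rule ccontr)
  assume "\<not> p ^ s dvd m"
  hence pos: "0 < m mod p ^ s" by (simp add: mod_greater_zero_iff_not_dvd)
  have lt: "m mod p ^ s < p ^ s" using assms(1) by simp
  have ge: "p ^ s \<le> g" using assms(3,4) by (rule dvd_imp_le)
  obtain u where u: "g - p ^ s = p ^ s * u" using dvd_diff_nat[OF assms(3) dvd_refl] by (rule dvdE)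
  define k where "k = g - p ^ s + m mod p ^ s"
  have k: "k mod p ^ s = m mod p ^ s" "k div p ^ s = (g - p ^ s) div p ^ s"
    unfolding k_def u using lt assms(1) by simp_all
  have "digit p e k \<le> digit p e m" for e
  proof (cases "e < s")
    case True
    thus ?thesis using digit_mod_power[of e s p] k(1) by (metis order_refl)
  next
    case False
    hence "digit p e k = digit p e (g - p ^ s)"
      using digit_div_power[of s e p] k(2) by simp
    thus ?thesis using assms(2) by (simp add: G_set_def)
  qed
  hence "k \<in> G_set p m" by (simp add: G_set_def)
  moreover have "g - p ^ s < k" "k < g" unfolding k_def using pos lt ge by linarith+
  ultimately show False using assms(5) by blast
qed

section \<open>The splitting given by a gap\<close>

lemma of_nat_poly_poly_coeff:
  "coeff (coeff (of_nat n * f) j) i = of_nat n * coeff (coeff f j) i" for f :: "'a::comm_ring_1 poly poly"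
  by (simp add: of_nat_poly)

lemma coeff_binomial_sum:
  fixes I :: "nat set"
  assumes "I \<subseteq> {..m}"
  shows "coeff (coeff (\<Sum>i\<in>I. of_nat (m choose i) * var_x ^ i * var_y ^ (m - i)) l) k
    = (if k \<in> I \<and> k + l = m then of_nat (m choose k) else (0 :: 'a::field))"
proof -
  have fin: "finite I" using assms by (rule finite_subset) simp
  have "coeff (coeff (\<Sum>i\<in>I. of_nat (m choose i) * var_x ^ i * var_y ^ (m - i)) l) k
    = (\<Sum>i\<in>I. if i = k then (if k + l = m then of_nat (m choose k) else 0) else (0 :: 'a))"
    unfolding coeff_sum mult.assoc of_nat_poly_poly_coeff coeff_var_x_power_mult_var_y_power
    using assms by (intro sum.cong) auto
  thus ?thesis using fin by (simp add: sum.delta)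
qed

text \<open>Under \<open>y = -x\<close> each summand becomes a signed binomial coefficient times
  \<open>x ^ m\<close>, and the alternating tail has a closed form.\<close>

lemma binomial_sum_antidiagonal:
  assumes "0 < g" "g \<le> m"
  shows "poly (\<Sum>i=g..m. of_nat (m choose i) * var_x ^ i * var_y ^ (m - i)) [:0, -1:]
    = [:0, 1:] ^ m * ((-1) ^ (m - g) * (of_nat ((m - 1) choose (g - 1)) :: 'a::field poly))"
proof -
  let ?X = "[:0, 1:] :: 'a poly"
  have "poly (\<Sum>i=g..m. of_nat (m choose i) * var_x ^ i * var_y ^ (m - i)) [:0, -1:]
      = (\<Sum>i=g..m. ?X ^ m * ((-1) ^ (m - i) * of_nat (m choose i)))"
    unfolding poly_sum
  proof (rule sum.cong[OF refl])
    fix i assume "i \<in> {g..m}"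
    hence "?X ^ m = ?X ^ i * ?X ^ (m - i)" by (simp flip: power_add)
    moreover have "[:0, -1:] ^ (m - i) = (-1) ^ (m - i) * ?X ^ (m - i)"
      using power_minus[of ?X "m - i"] by simp
    ultimately show "poly (of_nat (m choose i) * var_x ^ i * var_y ^ (m - i)) [:0, -1:]
        = ?X ^ m * ((-1) ^ (m - i) * of_nat (m choose i))"
      by (simp add: var_x_def var_y_def mult_ac)
  qed
  also have "\<dots> = ?X ^ m * ((-1) ^ (m - g) * of_nat ((m - 1) choose (g - 1)))"
    unfolding sum_distrib_left[symmetric] sum_alternating_binomial_tail[OF assms] ..
  finally show ?thesis .
qed

text \<open>The expansion of \<open>(x + y) ^ m\<close> is cut at the gap. The coefficients in
  \<open>ends\<close> give exactness, the monomials \<open>x ^ m\<close> and \<open>y ^ m\<close>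
  exclude the factors \<open>y\<close> and \<open>x\<close>, and \<open>tail\<close> excludes
  \<open>x + y\<close>.\<close>

lemma gap_splitting_binomial:
  assumes g: "0 < g" "g \<le> m" "g' \<le> m" "m - g' < g"
    and gap: "\<And>i. m - g' < i \<Longrightarrow> i < g \<Longrightarrow> of_nat (m choose i) = (0 :: 'a::field)"
    and ends: "of_nat (m choose g) \<noteq> (0 :: 'a)" "of_nat (m choose g') \<noteq> (0 :: 'a)"
    and tail: "of_nat ((m - 1) choose (g - 1)) \<noteq> (0 :: 'a)"
  shows "gap_splitting (\<Sum>i=g..m. of_nat (m choose i) * var_x ^ i * var_y ^ (m - i) :: 'a poly poly)
    (\<Sum>i\<le>m - g'. of_nat (m choose i) * var_x ^ i * var_y ^ (m - i)) g g' m (g + g' - m)"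
proof
  let ?T = "\<lambda>i. of_nat (m choose i) * var_x ^ i * var_y ^ (m - i) :: 'a poly poly"
  let ?a = "\<Sum>i=g..m. ?T i" and ?b = "\<Sum>i\<le>m - g'. ?T i"
  have cf: "coeff (coeff ?a l) k = (if k \<in> {g..m} \<and> k + l = m then of_nat (m choose k) else 0)"
    "coeff (coeff ?b l) k = (if k \<in> {..m - g'} \<and> k + l = m then of_nat (m choose k) else 0)" for k l
    by (intro coeff_binomial_sum; force)+
  have neutral: "?T i = 0" if "i \<in> {..m} - ({g..m} \<union> {..m - g'})" for i
  proof -
    have "[:[:of_nat (m choose i) :: 'a:]:] = 0" using gap[of i] that by auto
    thus ?thesis by (simp add: of_nat_poly)
  qed
  have "(\<Sum>i\<in>{g..m} \<union> {..m - g'}. ?T i) = (\<Sum>i\<le>m. ?T i)"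
    by (intro sum.mono_neutral_left ballI finite_atMost neutral) auto
  moreover have "(\<Sum>i\<in>{g..m} \<union> {..m - g'}. ?T i) = ?a + ?b"
    using g(4) by (intro sum.union_disjoint) (simp_all add: disjoint_iff)
  ultimately show "?a + ?b = (var_x + var_y) ^ m" unfolding binomial_ring by (simp only:)
  show "homogeneous m ?a" "homogeneous m ?b"
    unfolding homogeneous_def cf by auto
  show "var_x ^ g dvd ?a"
    by (intro dvd_sum dvd_mult2[OF dvd_mult[OF le_imp_power_dvd]]) simp
  show "var_y ^ g' dvd ?b"
    using g(3) by (intro dvd_sum dvd_mult[OF le_imp_power_dvd]) auto
  show "\<not> var_x ^ Suc g dvd ?a"
    using coeff_var_x_power_dvd[of "Suc g" ?a g "m - g"] ends(1) g(2) unfolding cf by auto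
  have "m choose (m - g') = m choose g'" using g(3) by (simp flip: binomial_symmetric)
  thus "\<not> var_y ^ Suc g' dvd ?b"
    using coeff_var_y_power_dvd[of "Suc g'" ?b g'] cf(2)[of g' "m - g'"] ends(2) g(3) by auto
  show "\<not> var_y dvd ?a"
    using coeff_var_y_power_dvd[of 1 ?a 0] cf(1)[of 0 m] g(2) by auto
  show "\<not> var_x dvd ?b"
    using coeff_var_x_power_dvd[of 1 ?b 0 m] cf(2)[of m 0] by auto
  have "of_nat ((m - 1) choose (g - 1)) \<noteq> (0 :: 'a poly)" using tail by (simp add: of_nat_poly)
  thus "\<not> var_x + var_y dvd ?a"
    unfolding var_x_plus_var_y_dvd_iff binomial_sum_antidiagonal[OF g(1,2)] by simp
  show "g + g' = m + (g + g' - m)" using g by simp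
qed

lemma gap_splitting_mod_ring:
  fixes p m g g' s :: nat
  defines "s \<equiv> low_exp p g"
  assumes p: "p = CARD('p::prime_card)"
    and S: "(g, g', m) \<in> S_set p m" and m: "m + p ^ s = g + g'"
  shows "\<exists>a b :: 'p mod_ring poly poly. gap_splitting a b g g' m (p ^ s)"
proof -
  have pr: "prime p" using p prime_card[where 'a = 'p] by simp
  note pred = S_set_predecessor[OF pr S]
  have g: "0 < g" "g \<le> m" using pred(4) G_set_le[OF pr pred(1)] by auto
  have of_nat_iff: "of_nat n = (0 :: 'p mod_ring) \<longleftrightarrow> p dvd n" for n
    using p by (simp add: of_nat_eq_0_iff_char_dvd)
  note s = low_exp_dvd[OF prime_gt_1_nat[OF pr] g(1), folded s_def]
  \<comment> \<open>The equation for \<open>m\<close> says that the predecessor of \<open>g\<close>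
    lies at distance exactly \<open>p ^ s\<close>.\<close>
  have h: "m - g' = g - p ^ s" using m pred(2) by linarith
  have "p ^ s dvd m"
    using pred(3,5) unfolding h by (rule low_exp_dvd_of_gap[OF prime_gt_1_nat[OF pr] _ s(1) g(1)])
  \<comment> \<open>Powers of \<open>p\<close> are compared in the absorption identity:
    \<open>(m choose g) * g\<close> contains exactly \<open>s\<close> of them, and \<open>m\<close>
    alone already provides \<open>s\<close> on the other side.\<close>
  have "\<not> p dvd ((m - 1) choose (g - 1))"
  proof
    assume "p dvd ((m - 1) choose (g - 1))"
    hence "p ^ s * p dvd m * ((m - 1) choose (g - 1))" using \<open>p ^ s dvd m\<close> by (rule mult_dvd_mono[rotated])
    also have "m * ((m - 1) choose (g - 1)) = (m choose g) * g"
      using binomial_absorption[of "g - 1" m] g(1) by (simp add: mult.commute)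
    finally have "p ^ Suc s dvd (m choose g) * g" by (simp add: mult.commute)
    moreover have "coprime (p ^ Suc s) (m choose g)"
      using pred(1) mem_G_set_iff[OF pr] pr by (metis coprime_power_left_iff prime_imp_coprime)
    ultimately show False using s(2) by (simp add: coprime_dvd_mult_right_iff)
  qed
  moreover have "\<not> p dvd (m choose g')"
    using pred(2,3) mem_G_set_iff[OF pr] binomial_symmetric[of g' m] by metis
  moreover have "\<not> p dvd (m choose g)"
    using pred(1) mem_G_set_iff[OF pr] by blast
  moreover have "p dvd (m choose i)" if "m - g' < i" "i < g" for i
    using pred(5)[OF that] mem_G_set_iff[OF pr] by blast
  moreover have "g + g' - m = p ^ s" using m by simp
  ultimately show ?thesis
    using gap_splitting_binomial[of g m g', where 'a = "'p mod_ring"] g pred(2,4)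
    unfolding of_nat_iff by metis
qed

section \<open>Balls as components\<close>

lemma mult_dist_adjacent:
  assumes "adjacent \<mu> \<nu>" shows "mult_dist \<nu> \<kappa> \<le> mult_dist \<mu> \<kappa> + 1"
  using assms by (cases \<mu>; cases \<nu>; cases \<kappa>) (auto simp: adjacent_def mult_dist_def)

lemma adjacent_sym: "adjacent \<mu> \<nu> \<Longrightarrow> adjacent \<nu> \<mu>"
  unfolding adjacent_def by blast

lemma mult_dist_nonneg: "0 \<le> mult_dist \<mu> \<kappa>"
  by (cases \<mu>; cases \<kappa>) (simp add: mult_dist_def)

lemma mult_dist_self [simp]: "mult_dist \<kappa> \<kappa> = 0"
  by (cases \<kappa>) (simp add: mult_dist_def)

text \<open>Joins each point of a ball to the center by a path inside the ball.\<close>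

lemma ex_adjacent_closer:
  assumes "\<mu> \<noteq> \<kappa>"
  shows "\<exists>\<nu>. adjacent \<mu> \<nu> \<and> mult_dist \<nu> \<kappa> = mult_dist \<mu> \<kappa> - 1"
proof -
  obtain i j k where \<mu>: "\<mu> = (i, j, k)" by (cases \<mu>)
  obtain a b c where \<kappa>: "\<kappa> = (a, b, c)" by (cases \<kappa>)
  consider "i < a" | "a < i" | "j < b" | "b < j" | "k < c" | "c < k"
    using assms \<mu> \<kappa> by fastforce
  thus ?thesis
  proof cases
    case 1 thus ?thesis by (intro exI[of _ "(i + 1, j, k)"]) (simp add: \<mu> \<kappa> adjacent_def mult_dist_def)
  next
    case 2 thus ?thesis by (intro exI[of _ "(i - 1, j, k)"]) (simp add: \<mu> \<kappa> adjacent_def mult_dist_def)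
  next
    case 3 thus ?thesis by (intro exI[of _ "(i, j + 1, k)"]) (simp add: \<mu> \<kappa> adjacent_def mult_dist_def)
  next
    case 4 thus ?thesis by (intro exI[of _ "(i, j - 1, k)"]) (simp add: \<mu> \<kappa> adjacent_def mult_dist_def)
  next
    case 5 thus ?thesis by (intro exI[of _ "(i, j, k + 1)"]) (simp add: \<mu> \<kappa> adjacent_def mult_dist_def)
  next
    case 6 thus ?thesis by (intro exI[of _ "(i, j, k - 1)"]) (simp add: \<mu> \<kappa> adjacent_def mult_dist_def)
  qed
qed

text \<open>Paths towards \<open>\<kappa>\<close> connect the ball. A path leaving it would meet the
  sphere of radius \<open>q\<close>, where \<open>\<Delta>\<close> vanishes; hence the formula is
  assumed on the closed ball.\<close>

lemma ball_mem_components: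
  assumes q: "0 < q"
    and \<Delta>: "\<And>\<mu>. mult_dist \<mu> \<kappa> \<le> int q \<Longrightarrow> int (\<Delta> K \<mu>) = int q - mult_dist \<mu> \<kappa>"
  shows "{\<mu>. mult_dist \<mu> \<kappa> < int q} \<in> components K"
proof -
  define R where "R = {(\<mu>, \<nu>). \<mu> \<in> \<Lambda>_pos K \<and> \<nu> \<in> \<Lambda>_pos K \<and> adjacent \<mu> \<nu>}"
  have pos: "\<mu> \<in> \<Lambda>_pos K" if "mult_dist \<mu> \<kappa> < int q" for \<mu>
    using that \<Delta>[of \<mu>] by (simp add: \<Lambda>_pos_def)
  have "(\<kappa>, \<mu>) \<in> R\<^sup>*" if "mult_dist \<mu> \<kappa> < int q" for \<mu>
    using that
  proof (induction "nat (mult_dist \<mu> \<kappa>)" arbitrary: \<mu> rule: less_induct)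
    case less
    show ?case
    proof (cases "\<mu> = \<kappa>")
      case False
      then obtain \<nu> where \<nu>: "adjacent \<mu> \<nu>" "mult_dist \<nu> \<kappa> = mult_dist \<mu> \<kappa> - 1"
        using ex_adjacent_closer by blast
      hence "(\<kappa>, \<nu>) \<in> R\<^sup>*" using less mult_dist_nonneg[of \<nu> \<kappa>] by (intro less.hyps) auto
      moreover have "(\<nu>, \<mu>) \<in> R" using \<nu> less.prems pos adjacent_sym by (auto simp: R_def)
      ultimately show ?thesis by (rule rtrancl.rtrancl_into_rtrancl)
    qed simp
  qed
  moreover have "mult_dist \<mu> \<kappa> < int q" if "(\<kappa>, \<mu>) \<in> R\<^sup>*" for \<mu>
    using that
  proof (induction rule: rtrancl_induct)
    case (step \<mu> \<nu>)
    \<comment> \<open>One step from the open ball stays in the closed one, and positivity of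
      \<open>\<Delta>\<close> at \<open>\<nu>\<close> then excludes the sphere.\<close>
    hence "mult_dist \<nu> \<kappa> \<le> int q" using mult_dist_adjacent[of \<mu> \<nu> \<kappa>] by (auto simp: R_def)
    thus ?case using \<Delta>[of \<nu>] step.hyps(2) by (auto simp: R_def \<Lambda>_pos_def)
  qed (use q in simp)
  ultimately have "{\<mu>. mult_dist \<mu> \<kappa> < int q} = R\<^sup>* `` {\<kappa>}" by auto
  thus ?thesis
    unfolding components_def R_def[symmetric] using pos[of \<kappa>] q by (simp add: quotientI)
qed

lemma (in gap_splitting) center_mem_centers_level:
  assumes "0 < q" "g \<le> m" "g' \<le> m"
  shows "(g, g', m) \<in> centers_level TYPE('a) q"
proof -
  let ?\<kappa> = "(g, g', m)"
  have \<Delta>: "\<Delta> TYPE('a) ?\<kappa> = q" using \<Delta>_within_ball[of ?\<kappa>] by simp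
  \<comment> \<open>At the center the sum of any two entries exceeds the third by at least
    \<open>q\<close>; a move of distance less than \<open>q\<close> changes this excess by less than
    \<open>q\<close>.\<close>
  have "balanced \<mu>" if "mult_dist \<mu> ?\<kappa> < int q" for \<mu>
  proof -
    obtain i j k where "\<mu> = (i, j, k)" by (cases \<mu>)
    thus ?thesis using that assms(2,3) size
      by (simp only: mult_dist_def balanced_def mult_size_def split_conv) linarith
  qed
  moreover have "\<mu> \<in> \<Lambda>_pos TYPE('a)" if "mult_dist \<mu> ?\<kappa> < int q" for \<mu>
    using that \<Delta>_within_ball[of \<mu>] by (simp add: \<Lambda>_pos_def)
  ultimately have "{\<mu>. mult_dist \<mu> ?\<kappa> < int q} \<subseteq> \<Lambda>_pos_bal TYPE('a)" by (auto simp: \<Lambda>_pos_bal_def)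
  moreover have "{\<mu>. mult_dist \<mu> ?\<kappa> < int q} \<in> components TYPE('a)"
    using ball_mem_components[OF assms(1) \<Delta>_within_ball] .
  ultimately show ?thesis
    unfolding centers_level_def centers_def is_center_def using \<Delta> by auto
qed

text \<open>The prime field is the type \<open>'p mod_ring\<close>, so \<open>p\<close> enters as a
  cardinality; integers in the equation for \<open>m\<close> avoid truncated subtraction.\<close>

theorem theorem5p18:
  fixes p m g g' :: nat
  assumes "p = CARD('p::prime_card)"
    and "m > 0"
    and "(g, g', m) \<in> S_set p m"
    and "int m = int g + int g' - int (p ^ low_exp p g)"
  shows "(g, g', m) \<in> centers_level TYPE('p mod_ring) (p ^ low_exp p g)"
proof -
  have pr: "prime p" using assms(1) prime_card[where 'a = 'p] by simp
  obtain a b :: "'p mod_ring poly poly" where "gap_splitting a b g g' m (p ^ low_exp p g)"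
    using gap_splitting_mod_ring[OF assms(1,3)] assms(4) by (metis add_diff_cancel_right' diff_add_cancel of_nat_add of_nat_eq_iff)
  moreover have "g \<le> m" "g' \<le> m"
    using S_set_predecessor(1,2)[OF pr assms(3)] G_set_le[OF pr] by auto
  ultimately show ?thesis
    using prime_gt_0_nat[OF pr] by (intro gap_splitting.center_mem_centers_level) auto
qed

end
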